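(* Let $n\ge1$ and let $q\in\mathbb{C}$ be nonzero. The derivation algebra $\mathcal{D}_q(2n)$ can be equipped with a Hopf algebra structure whose coproduct $\Delta:\mathcal{D}_q(2n)\to\mathcal{D}_q(2n)\otimes\mathcal{D}_q(2n)$, counit $\varepsilon:\mathcal{D}_q(2n)\to\mathbb{C}$ and antipode $S:\mathcal{D}_q(2n)\to\mathcal{D}_q(2n)$ are given on the generators, for $i=1,\dots,n$, by $$\Delta(\sigma_i)=\sigma_i\otimes\sigma_i,\qquad \Delta(\partial_i)=\partial_i\otimes 1+\sigma_i\otimes\partial_i,$$ $$\varepsilon(\sigma_i)=1,\qquad \varepsilon(\partial_i)=0,$$ $$S(\sigma_i)=\sigma_i^{-1},\qquad S(\partial_i)=-\sigma_i^{-1}\partial_i.$$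
   Context: The ground field is $\mathbb{C}$. For $\alpha,\beta\in\mathbb{Z}^n$ put $\alpha\ast\beta=\sum_{j=1}^{n-1}\sum_{i>j}(j-i)\alpha_i\beta_j$ and $\eta(\alpha,\beta)=q^{\alpha\ast\beta-\beta\ast\alpha}$. Let $\varepsilon_1,\dots,\varepsilon_n$ be the standard basis of $\mathbb{Z}^n$; then $\eta(\varepsilon_i,\varepsilon_j)=q^{j-i}$. (The counit $\varepsilon$ is not to be confused with the vectors $\varepsilon_i$.) The algebra $\mathcal{D}_q(2n)$ is the unital associative $\mathbb{C}$-algebra generated by $\partial_1,\dots,\partial_n$ and invertible elements $\sigma_1,\dots,\sigma_n$ (so $\sigma_i^{-1}$ belongs to the algebra), subject to the relations, for all $1\le i,j\le n$, $$\partial_i\partial_j=\eta(\varepsilon_i,\varepsilon_j)\,\partial_j\partial_i,\qquad \sigma_i\sigma_j=\sigma_j\sigma_i,\qquad \sigma_j\partial_i=\eta(\varepsilon_j,\varepsilon_i)\,\partial_i\sigma_j.$$ Here $1$ is the unit of $\mathcal{D}_q(2n)$ (the identity mapping, when the generators are viewed as operators). As for any Hopf algebra, $\Delta$ and $\varepsilon$ are algebra homomorphisms and $S$ is an algebra antihomomorphism; the multiplication on $\mathcal{D}_q(2n)\otimes\mathcal{D}_q(2n)$ is $(a\otimes b)(c\otimes d)=ac\otimes bd$. *)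

theory Defs
  imports Complex_Main "HOL-Algebra.Module" "HOL-Algebra.QuotRing" "HOL-Library.Poly_Mapping"
begin

section \<open>Associative unital algebras over the complex numbers\<close>

definition complexes :: "(complex, complex) module" where
  "complexes =
    \<lparr>carrier = UNIV, mult = (*), one = 1, zero = 0, add = (+), smult = (*)\<rparr>"

text \<open>The library locale \<open>algebra\<close> requires a commutative multiplication, hence this variant.\<close>

locale complex_algebra = Module.module complexes A + ring A for A (structure) +
  assumes smult_mult_left:
      "\<lbrakk>x \<in> carrier A; y \<in> carrier A\<rbrakk> \<Longrightarrow> (c \<odot> x) \<otimes> y = c \<odot> (x \<otimes> y)"
    and smult_mult_right:
      "\<lbrakk>x \<in> carrier A; y \<in> carrier A\<rbrakk> \<Longrightarrow> x \<otimes> (c \<odot> y) = c \<odot> (x \<otimes> y)"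

definition linear_maps ::
    "(complex, 'a, 'm) module_scheme \<Rightarrow> (complex, 'b, 'n) module_scheme \<Rightarrow> ('a \<Rightarrow> 'b) set" where
  "linear_maps A B = {f \<in> carrier A \<rightarrow> carrier B.
     (\<forall>x\<in>carrier A. \<forall>y\<in>carrier A. f (x \<oplus>\<^bsub>A\<^esub> y) = f x \<oplus>\<^bsub>B\<^esub> f y) \<and>
     (\<forall>c. \<forall>x\<in>carrier A. f (c \<odot>\<^bsub>A\<^esub> x) = c \<odot>\<^bsub>B\<^esub> f x)}"

definition alg_homs ::
    "(complex, 'a, 'm) module_scheme \<Rightarrow> (complex, 'b, 'n) module_scheme \<Rightarrow> ('a \<Rightarrow> 'b) set" where
  "alg_homs A B = linear_maps A B \<inter> ring_hom A B"

definition alg_antihoms ::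
    "(complex, 'a, 'm) module_scheme \<Rightarrow> (complex, 'b, 'n) module_scheme \<Rightarrow> ('a \<Rightarrow> 'b) set" where
  "alg_antihoms A B = {f \<in> linear_maps A B. f \<one>\<^bsub>A\<^esub> = \<one>\<^bsub>B\<^esub> \<and>
     (\<forall>x\<in>carrier A. \<forall>y\<in>carrier A. f (x \<otimes>\<^bsub>A\<^esub> y) = f y \<otimes>\<^bsub>B\<^esub> f x)}"

text \<open>The monoid algebra over \<open>G\<close>: formal finite complex linear combinations of elements of \<open>G\<close>.\<close>

definition monoid_algebra ::
    "('g, 'm) monoid_scheme \<Rightarrow> (complex, 'g \<Rightarrow>\<^sub>0 complex) module" where
  "monoid_algebra G =
    \<lparr>carrier = {f. Poly_Mapping.keys f \<subseteq> carrier G},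
     mult = (\<lambda>f g. \<Sum>x\<in>Poly_Mapping.keys f. \<Sum>y\<in>Poly_Mapping.keys g.
               Poly_Mapping.single (x \<otimes>\<^bsub>G\<^esub> y) (Poly_Mapping.lookup f x * Poly_Mapping.lookup g y)),
     one = Poly_Mapping.single \<one>\<^bsub>G\<^esub> 1,
     zero = 0,
     add = (+),
     smult = (\<lambda>c. Poly_Mapping.map ((*) c))\<rparr>"

text \<open>\<open>A Quot I\<close> together with the induced scalar multiplication.\<close>

definition quot_algebra ::
    "(complex, 'a, 'm) module_scheme \<Rightarrow> 'a set \<Rightarrow> (complex, 'a set) module" where
  "quot_algebra A I =
    ring.extend (A Quot I)
      (module.fields (\<lambda>c X. \<Union>x\<in>X. I +>\<^bsub>A\<^esub> (c \<odot>\<^bsub>A\<^esub> x)))"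


section \<open>Tensor products\<close>

text \<open>
  \<open>monoid_algebra (A \<times>\<times> B)\<close> is the free vector space on the pairs \<open>(a, b)\<close>, carrying the
  multiplication \<open>(a, b) (c, d) = (a c, b d)\<close>. The tensor product is its quotient by the subspace
  spanned by the bilinearity relators.
\<close>

definition tensor_relators ::
    "(complex, 'a, 'm) module_scheme \<Rightarrow> (complex, 'b, 'n) module_scheme
      \<Rightarrow> ('a \<times> 'b \<Rightarrow>\<^sub>0 complex) set" where
  "tensor_relators A B =
     {Poly_Mapping.single (a \<oplus>\<^bsub>A\<^esub> a', b) 1
        - Poly_Mapping.single (a, b) 1 - Poly_Mapping.single (a', b) 1 | a a' b.
        a \<in> carrier A \<and> a' \<in> carrier A \<and> b \<in> carrier B} \<union>
     {Poly_Mapping.single (a, b \<oplus>\<^bsub>B\<^esub> b') 1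
        - Poly_Mapping.single (a, b) 1 - Poly_Mapping.single (a, b') 1 | a b b'.
        a \<in> carrier A \<and> b \<in> carrier B \<and> b' \<in> carrier B} \<union>
     {Poly_Mapping.single (c \<odot>\<^bsub>A\<^esub> a, b) 1 - Poly_Mapping.single (a, b) c | c a b.
        a \<in> carrier A \<and> b \<in> carrier B} \<union>
     {Poly_Mapping.single (a, c \<odot>\<^bsub>B\<^esub> b) 1 - Poly_Mapping.single (a, b) c | c a b.
        a \<in> carrier A \<and> b \<in> carrier B}"

definition tensor_null ::
    "(complex, 'a, 'm) module_scheme \<Rightarrow> (complex, 'b, 'n) module_scheme
      \<Rightarrow> ('a \<times> 'b \<Rightarrow>\<^sub>0 complex) set" where
  "tensor_null A B =
     \<Inter>{N. submodule N complexes (monoid_algebra (A \<times>\<times> B)) \<and> tensor_relators A B \<subseteq> N}"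

definition tensor_algebra ::
    "(complex, 'a, 'm) module_scheme \<Rightarrow> (complex, 'b, 'n) module_scheme
      \<Rightarrow> (complex, ('a \<times> 'b \<Rightarrow>\<^sub>0 complex) set) module"  (infixr \<open>\<otimes>\<^sub>A\<close> 75) where
  "A \<otimes>\<^sub>A B = quot_algebra (monoid_algebra (A \<times>\<times> B)) (tensor_null A B)"

text \<open>The element \<open>a \<otimes> b\<close>.\<close>

definition pure_tensor ::
    "(complex, 'a, 'm) module_scheme \<Rightarrow> (complex, 'b, 'n) module_scheme
      \<Rightarrow> 'a \<Rightarrow> 'b \<Rightarrow> ('a \<times> 'b \<Rightarrow>\<^sub>0 complex) set" where
  "pure_tensor A B a b =
     tensor_null A B +>\<^bsub>monoid_algebra (A \<times>\<times> B)\<^esub> Poly_Mapping.single (a, b) 1"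

text \<open>
  The linear map to \<open>V\<close> determined by \<open>a \<otimes> b \<mapsto> \<phi> (a, b)\<close>, for bilinear \<open>\<phi>\<close>: extend \<open>\<phi>\<close> linearly to
  the free vector space; the extension is then constant on each coset.
\<close>

definition tensor_lift ::
    "(complex, 'v, 'k) module_scheme \<Rightarrow> ('a \<times> 'b \<Rightarrow> 'v) \<Rightarrow> ('a \<times> 'b \<Rightarrow>\<^sub>0 complex) set \<Rightarrow> 'v" where
  "tensor_lift V \<phi> X =
     the_elem ((\<lambda>x. \<Oplus>\<^bsub>V\<^esub>p\<in>Poly_Mapping.keys x. Poly_Mapping.lookup x p \<odot>\<^bsub>V\<^esub> \<phi> p) ` X)"

text \<open>\<open>f \<otimes> g\<close>, with values in \<open>A \<otimes> B\<close>.\<close>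

definition tensor_map ::
    "(complex, 'a, 'm) module_scheme \<Rightarrow> (complex, 'b, 'n) module_scheme
      \<Rightarrow> ('c \<Rightarrow> 'a) \<Rightarrow> ('d \<Rightarrow> 'b)
      \<Rightarrow> ('c \<times> 'd \<Rightarrow>\<^sub>0 complex) set \<Rightarrow> ('a \<times> 'b \<Rightarrow>\<^sub>0 complex) set" where
  "tensor_map A B f g = tensor_lift (A \<otimes>\<^sub>A B) (\<lambda>(c, d). pure_tensor A B (f c) (g d))"

text \<open>The canonical map from \<open>(A \<otimes> B) \<otimes> C\<close> to \<open>A \<otimes> (B \<otimes> C)\<close>.\<close>

definition tensor_assoc where
  "tensor_assoc A B C =
     tensor_lift (A \<otimes>\<^sub>A (B \<otimes>\<^sub>A C))
       (\<lambda>(t, c). tensor_lift (A \<otimes>\<^sub>A (B \<otimes>\<^sub>A C))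
          (\<lambda>(a, b). pure_tensor A (B \<otimes>\<^sub>A C) a (pure_tensor B C b c)) t)"

definition mult_map ::
    "(complex, 'a, 'm) module_scheme \<Rightarrow> ('a \<times> 'a \<Rightarrow>\<^sub>0 complex) set \<Rightarrow> 'a" where
  "mult_map A = tensor_lift A (\<lambda>(a, b). a \<otimes>\<^bsub>A\<^esub> b)"


section \<open>Hopf algebras\<close>

text \<open>
  In the counit axioms, \<open>H\<close> is identified with \<open>\<complex> \<otimes> H\<close> and with \<open>H \<otimes> \<complex>\<close> through the canonical
  isomorphisms \<open>x \<mapsto> 1 \<otimes> x\<close> and \<open>x \<mapsto> x \<otimes> 1\<close>.
\<close>

locale hopf_algebra = complex_algebra H for H (structure) +
  fixes \<Delta> :: "'a \<Rightarrow> ('a \<times> 'a \<Rightarrow>\<^sub>0 complex) set"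
    and \<epsilon> :: "'a \<Rightarrow> complex"
    and S :: "'a \<Rightarrow> 'a"
  assumes comult_hom: "\<Delta> \<in> alg_homs H (H \<otimes>\<^sub>A H)"
    and counit_hom: "\<epsilon> \<in> alg_homs H complexes"
    and antipode_linear: "S \<in> linear_maps H H"
    and coassoc: "x \<in> carrier H \<Longrightarrow>
      tensor_assoc H H H (tensor_map (H \<otimes>\<^sub>A H) H \<Delta> id (\<Delta> x)) = tensor_map H (H \<otimes>\<^sub>A H) id \<Delta> (\<Delta> x)"
    and counit_left: "x \<in> carrier H \<Longrightarrow>
      tensor_map complexes H \<epsilon> id (\<Delta> x) = pure_tensor complexes H 1 x"
    and counit_right: "x \<in> carrier H \<Longrightarrow>
      tensor_map H complexes id \<epsilon> (\<Delta> x) = pure_tensor H complexes x 1"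
    and antipode_left: "x \<in> carrier H \<Longrightarrow>
      mult_map H (tensor_map H H S id (\<Delta> x)) = \<epsilon> x \<odot> \<one>"
    and antipode_right: "x \<in> carrier H \<Longrightarrow>
      mult_map H (tensor_map H H id S (\<Delta> x)) = \<epsilon> x \<odot> \<one>"


section \<open>The derivation algebra\<close>

text \<open>Elements of \<open>\<int>\<^sup>n\<close> are functions on \<open>nat\<close>, of which only the values at \<open>1, \<dots>, n\<close> matter.\<close>

definition star :: "nat \<Rightarrow> (nat \<Rightarrow> int) \<Rightarrow> (nat \<Rightarrow> int) \<Rightarrow> int" where
  "star n \<alpha> \<beta> = (\<Sum>j=1..n-1. \<Sum>i=j+1..n. (int j - int i) * \<alpha> i * \<beta> j)"

definition eta :: "nat \<Rightarrow> complex \<Rightarrow> (nat \<Rightarrow> int) \<Rightarrow> (nat \<Rightarrow> int) \<Rightarrow> complex" where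
  "eta n q \<alpha> \<beta> = q powi (star n \<alpha> \<beta> - star n \<beta> \<alpha>)"

definition std_basis :: "nat \<Rightarrow> nat \<Rightarrow> int" where
  "std_basis i = (\<lambda>k. if k = i then 1 else 0)"

lemma eta_std_basis:
  assumes "i \<in> {1..n}" "j \<in> {1..n}"
  shows "eta n q (std_basis i) (std_basis j) = q powi (int j - int i)"
proof -
  have star: "star n (std_basis a) (std_basis b) = (if b < a then int b - int a else 0)"
    if ab: "a \<in> {1..n}" "b \<in> {1..n}" for a b
  proof -
    have "(\<Sum>i=k+1..n. (int k - int i) * std_basis a i * std_basis b k)
        = (if k = b then (if k < a then int k - int a else 0) else 0)" for k
    proof -
      have "(\<Sum>i=k+1..n. (int k - int i) * std_basis a i * std_basis b k)
          = (\<Sum>i=k+1..n. if i = a then (int k - int a) * std_basis b k else 0)"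
        by (intro sum.cong) (auto simp: std_basis_def)
      also have "\<dots> = (if a \<in> {k+1..n} then (int k - int a) * std_basis b k else 0)"
        by simp
      finally show ?thesis using ab by (auto simp: std_basis_def)
    qed
    then have "star n (std_basis a) (std_basis b)
        = (\<Sum>k=1..n-1. if k = b then (if k < a then int k - int a else 0) else 0)"
      by (simp add: star_def)
    also have "\<dots> = (if b \<in> {1..n-1} then (if b < a then int b - int a else 0) else 0)"
      by simp
    finally show ?thesis using ab by auto
  qed
  show ?thesis using assms by (auto simp: eta_def star)
qed

datatype gen = Gen_partial nat | Gen_sigma nat | Gen_sigma_inv nat

definition gens :: "nat \<Rightarrow> gen set" where
  "gens n = Gen_partial ` {1..n} \<union> Gen_sigma ` {1..n} \<union> Gen_sigma_inv ` {1..n}"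

definition free_monoid :: "'g set \<Rightarrow> 'g list monoid" where
  "free_monoid X = \<lparr>carrier = lists X, mult = (@), one = []\<rparr>"

abbreviation free_algebra :: "nat \<Rightarrow> (complex, gen list \<Rightarrow>\<^sub>0 complex) module" where
  "free_algebra n \<equiv> monoid_algebra (free_monoid (gens n))"

text \<open>Each relation \<open>u = c v\<close> between words \<open>u\<close> and \<open>v\<close> becomes the relator \<open>u - c v\<close>.\<close>

definition derivation_relators :: "nat \<Rightarrow> complex \<Rightarrow> (gen list \<Rightarrow>\<^sub>0 complex) set" where
  "derivation_relators n q = (\<Union>i\<in>{1..n}. \<Union>j\<in>{1..n}.
     {Poly_Mapping.single [Gen_partial i, Gen_partial j] 1
        - Poly_Mapping.single [Gen_partial j, Gen_partial i] (eta n q (std_basis i) (std_basis j)),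
      Poly_Mapping.single [Gen_sigma i, Gen_sigma j] 1
        - Poly_Mapping.single [Gen_sigma j, Gen_sigma i] 1,
      Poly_Mapping.single [Gen_sigma j, Gen_partial i] 1
        - Poly_Mapping.single [Gen_partial i, Gen_sigma j] (eta n q (std_basis j) (std_basis i)),
      Poly_Mapping.single [Gen_sigma i, Gen_sigma_inv i] 1 - Poly_Mapping.single [] 1,
      Poly_Mapping.single [Gen_sigma_inv i, Gen_sigma i] 1 - Poly_Mapping.single [] 1})"

definition derivation_ideal :: "nat \<Rightarrow> complex \<Rightarrow> (gen list \<Rightarrow>\<^sub>0 complex) set" where
  "derivation_ideal n q = genideal (free_algebra n) (derivation_relators n q)"

definition derivation_algebra :: "nat \<Rightarrow> complex \<Rightarrow> (complex, (gen list \<Rightarrow>\<^sub>0 complex) set) module" where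
  "derivation_algebra n q = quot_algebra (free_algebra n) (derivation_ideal n q)"

definition partial_elt :: "nat \<Rightarrow> complex \<Rightarrow> nat \<Rightarrow> (gen list \<Rightarrow>\<^sub>0 complex) set" where
  "partial_elt n q i = derivation_ideal n q +>\<^bsub>free_algebra n\<^esub> Poly_Mapping.single [Gen_partial i] 1"

definition sigma_elt :: "nat \<Rightarrow> complex \<Rightarrow> nat \<Rightarrow> (gen list \<Rightarrow>\<^sub>0 complex) set" where
  "sigma_elt n q i = derivation_ideal n q +>\<^bsub>free_algebra n\<^esub> Poly_Mapping.single [Gen_sigma i] 1"

end

theory Submission
  imports Defs
begin

text \<open>
  A Hopf algebra structure on an algebra given by generators and relations is determined by the
  values of its structure maps on generators, and only two things have to be verified: that these
  values satisfy the defining relations, so that the maps exist, and that the Hopf axioms hold on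
  generators.

  For the existence of the maps, call families \<open>d\<close>, \<open>s\<close>, \<open>t\<close> in an algebra \<open>A\<close> a derivation system if
  they satisfy the relations of \<open>\<partial>\<^sub>i\<close>, \<open>\<sigma>\<^sub>i\<close>, \<open>\<sigma>\<^sub>i\<^sup>-\<^sup>1\<close>. The derivation algebra carries the universal
  derivation system (\<open>derivation_system_universal\<close>, \<open>derivation_algebra_lift\<close>). Any derivation
  system gives one in \<open>A \<otimes> A\<close>, namely \<open>d\<^sub>i \<otimes> 1 + s\<^sub>i \<otimes> d\<^sub>i\<close>, \<open>s\<^sub>i \<otimes> s\<^sub>i\<close>, \<open>t\<^sub>i \<otimes> t\<^sub>i\<close>, and one in the
  opposite algebra, namely \<open>- t\<^sub>i d\<^sub>i\<close>, \<open>t\<^sub>i\<close>, \<open>s\<^sub>i\<close>; and \<open>0\<close>, \<open>1\<close>, \<open>1\<close> is one in \<open>\<complex>\<close>. These yield \<open>\<Delta>\<close>,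
  the antihomomorphism \<open>S\<close>, and \<open>\<epsilon>\<close>. The computation behind the first two is that the factor
  \<open>q\<^sup>j\<^sup>-\<^sup>i\<close> from moving \<open>s\<^sub>i\<close> past \<open>d\<^sub>j\<close> equals the factor in \<open>d\<^sub>i d\<^sub>j = q\<^sup>j\<^sup>-\<^sup>i d\<^sub>j d\<^sub>i\<close>, and that
  exchanging \<open>i\<close> and \<open>j\<close> inverts it; this is where \<open>q \<noteq> 0\<close> enters.

  The coassociativity and counit axioms compare algebra homomorphisms, so it suffices to check them on
  generators. The antipode axioms are not of this kind, because \<open>m \<circ> (S \<otimes> id)\<close> is in general not
  multiplicative on tensors.
  But if \<open>m((S \<otimes> id)(t)) = c 1\<close>, then \<open>m((S \<otimes> id)(t u)) = c m((S \<otimes> id)(u))\<close> for every tensor \<open>u\<close>,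
  because \<open>S\<close> reverses products and the scalar can be pulled out of the middle (\<open>conv_left_mult\<close>).
  Hence the elements at which the axiom holds form a subalgebra (\<open>hopf_algebra_from_generators\<close>).
  On a generator the axioms are verified once for group-like elements, covering \<open>\<sigma>\<^sub>i\<close> and its
  inverse, and once for skew-primitive elements, covering \<open>\<partial>\<^sub>i\<close>.

  All of this rests on the concrete models: formal linear combinations, cosets of an ideal, and the
  tensor product as a quotient of the monoid algebra on pairs. For each of them the universal property
  is proved once (\<open>monoid_algebra_lift\<close>, \<open>quot_lift_alg_hom\<close>, \<open>tensor_lift_pure\<close>). Monomials
  span the monoid algebra and pure tensors span the tensor product, and later arguments only evaluate
  maps on these elements.
\<close>

section \<open>Linear maps and algebra homomorphisms\<close>

lemma complexes_simps [simp]: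
  "carrier complexes = UNIV" "x \<otimes>\<^bsub>complexes\<^esub> y = x * y" "\<one>\<^bsub>complexes\<^esub> = 1"
  "\<zero>\<^bsub>complexes\<^esub> = 0" "x \<oplus>\<^bsub>complexes\<^esub> y = x + y" "c \<odot>\<^bsub>complexes\<^esub> x = c * x"
  by (simp_all add: complexes_def)

lemma cring_complexes: "cring complexes"
  by (rule cringI, rule abelian_groupI)
     (auto intro!: comm_monoidI simp: algebra_simps intro: exI[of _ "- x" for x])

lemma complex_algebraI:
  fixes A (structure)
  assumes "ring A"
    and "\<And>c x. x \<in> carrier A \<Longrightarrow> c \<odot> x \<in> carrier A"
    and "\<And>b c x. x \<in> carrier A \<Longrightarrow> (b + c) \<odot> x = b \<odot> x \<oplus> c \<odot> x"
    and "\<And>c x y. \<lbrakk>x \<in> carrier A; y \<in> carrier A\<rbrakk> \<Longrightarrow> c \<odot> (x \<oplus> y) = c \<odot> x \<oplus> c \<odot> y"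
    and "\<And>b c x. x \<in> carrier A \<Longrightarrow> (b * c) \<odot> x = b \<odot> (c \<odot> x)"
    and "\<And>x. x \<in> carrier A \<Longrightarrow> 1 \<odot> x = x"
    and "\<And>c x y. \<lbrakk>x \<in> carrier A; y \<in> carrier A\<rbrakk> \<Longrightarrow> (c \<odot> x) \<otimes> y = c \<odot> (x \<otimes> y)"
    and "\<And>c x y. \<lbrakk>x \<in> carrier A; y \<in> carrier A\<rbrakk> \<Longrightarrow> x \<otimes> (c \<odot> y) = c \<odot> (x \<otimes> y)"
  shows "complex_algebra A"
  unfolding complex_algebra_def complex_algebra_axioms_def
  using assms by (auto intro!: moduleI cring_complexes ring.is_abelian_group)

lemma complex_algebra_complexes: "complex_algebra complexes"
  by (rule complex_algebraI) (auto intro: cring.axioms cring_complexes simp: algebra_simps)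

context complex_algebra
begin

lemma
  shows vector_space: "Module.module complexes A"
    and smult_in [simp, intro]: "x \<in> carrier A \<Longrightarrow> c \<odot> x \<in> carrier A"
    and smult_add_left: "x \<in> carrier A \<Longrightarrow> (b + c) \<odot> x = b \<odot> x \<oplus> c \<odot> x"
    and smult_add_right: "\<lbrakk>x \<in> carrier A; y \<in> carrier A\<rbrakk> \<Longrightarrow> c \<odot> (x \<oplus> y) = c \<odot> x \<oplus> c \<odot> y"
    and smult_smult: "x \<in> carrier A \<Longrightarrow> b \<odot> (c \<odot> x) = (b * c) \<odot> x"
    and smult_1 [simp]: "x \<in> carrier A \<Longrightarrow> 1 \<odot> x = x"
    and smult_0 [simp]: "x \<in> carrier A \<Longrightarrow> 0 \<odot> x = \<zero>"
    and smult_zero [simp]: "c \<odot> \<zero> = \<zero>"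
    and smult_minus1: "x \<in> carrier A \<Longrightarrow> (- 1) \<odot> x = \<ominus> x"
proof -
  show "Module.module complexes A" by unfold_locales
  show "x \<in> carrier A \<Longrightarrow> c \<odot> x \<in> carrier A" by simp
  show "x \<in> carrier A \<Longrightarrow> (b + c) \<odot> x = b \<odot> x \<oplus> c \<odot> x" using smult_l_distr[of b c x] by simp
  show "\<lbrakk>x \<in> carrier A; y \<in> carrier A\<rbrakk> \<Longrightarrow> c \<odot> (x \<oplus> y) = c \<odot> x \<oplus> c \<odot> y" by (simp add: smult_r_distr)
  show "x \<in> carrier A \<Longrightarrow> b \<odot> (c \<odot> x) = (b * c) \<odot> x" using smult_assoc1[of b c x] by simp
  show one: "x \<in> carrier A \<Longrightarrow> 1 \<odot> x = x" using smult_one[of x] by simp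
  show "x \<in> carrier A \<Longrightarrow> 0 \<odot> x = \<zero>" using smult_l_null[of x] by simp
  show "c \<odot> \<zero> = \<zero>" by simp
  have "\<ominus>\<^bsub>complexes\<^esub> 1 = - 1"
    using cring_complexes R.minus_equality[of "-1" "1"] by simp
  then show "x \<in> carrier A \<Longrightarrow> (- 1) \<odot> x = \<ominus> x" using smult_l_minus[of 1 x] one by simp
qed

end

lemma linear_mapsI:
  assumes "\<And>x. x \<in> carrier A \<Longrightarrow> f x \<in> carrier B"
    and "\<And>x y. \<lbrakk>x \<in> carrier A; y \<in> carrier A\<rbrakk> \<Longrightarrow> f (x \<oplus>\<^bsub>A\<^esub> y) = f x \<oplus>\<^bsub>B\<^esub> f y"
    and "\<And>c x. x \<in> carrier A \<Longrightarrow> f (c \<odot>\<^bsub>A\<^esub> x) = c \<odot>\<^bsub>B\<^esub> f x"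
  shows "f \<in> linear_maps A B"
  using assms by (auto simp: linear_maps_def)

lemma linear_mapsD:
  assumes "f \<in> linear_maps A B"
  shows "x \<in> carrier A \<Longrightarrow> f x \<in> carrier B"
    and "\<lbrakk>x \<in> carrier A; y \<in> carrier A\<rbrakk> \<Longrightarrow> f (x \<oplus>\<^bsub>A\<^esub> y) = f x \<oplus>\<^bsub>B\<^esub> f y"
    and "x \<in> carrier A \<Longrightarrow> f (c \<odot>\<^bsub>A\<^esub> x) = c \<odot>\<^bsub>B\<^esub> f x"
  using assms by (auto simp: linear_maps_def)

lemma linear_maps_zero:
  assumes "complex_algebra A" "complex_algebra B" "f \<in> linear_maps A B"
  shows "f \<zero>\<^bsub>A\<^esub> = \<zero>\<^bsub>B\<^esub>"
proof -
  interpret A: complex_algebra A by fact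
  interpret B: complex_algebra B by fact
  have "f (0 \<odot>\<^bsub>A\<^esub> \<zero>\<^bsub>A\<^esub>) = 0 \<odot>\<^bsub>B\<^esub> f \<zero>\<^bsub>A\<^esub>"
    using linear_mapsD(3)[OF assms(3)] by blast
  then show ?thesis using linear_mapsD(1)[OF assms(3)] by simp
qed

lemma linear_maps_comp:
  "\<lbrakk>f \<in> linear_maps A B; g \<in> linear_maps B C\<rbrakk> \<Longrightarrow> (\<lambda>x. g (f x)) \<in> linear_maps A C"
  by (rule linear_mapsI) (simp_all add: linear_mapsD)

lemma linear_maps_id: "id \<in> linear_maps A A"
  by (auto simp: linear_maps_def)

lemma alg_homsI:
  assumes "f \<in> linear_maps A B" "f \<one>\<^bsub>A\<^esub> = \<one>\<^bsub>B\<^esub>"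
    and "\<And>x y. \<lbrakk>x \<in> carrier A; y \<in> carrier A\<rbrakk> \<Longrightarrow> f (x \<otimes>\<^bsub>A\<^esub> y) = f x \<otimes>\<^bsub>B\<^esub> f y"
  shows "f \<in> alg_homs A B"
  using assms by (auto simp: alg_homs_def ring_hom_def linear_maps_def)

lemma alg_homsD:
  assumes "f \<in> alg_homs A B"
  shows "f \<in> linear_maps A B" "f \<one>\<^bsub>A\<^esub> = \<one>\<^bsub>B\<^esub>"
    and "\<lbrakk>x \<in> carrier A; y \<in> carrier A\<rbrakk> \<Longrightarrow> f (x \<otimes>\<^bsub>A\<^esub> y) = f x \<otimes>\<^bsub>B\<^esub> f y"
  using assms by (auto simp: alg_homs_def ring_hom_def)

lemma alg_homs_comp:
  "\<lbrakk>f \<in> alg_homs A B; g \<in> alg_homs B C\<rbrakk> \<Longrightarrow> (\<lambda>x. g (f x)) \<in> alg_homs A C"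
  by (rule alg_homsI) (auto dest: alg_homsD linear_mapsD intro: linear_maps_comp
       simp: alg_homsD(2,3) linear_mapsD(1)[OF alg_homsD(1)])

lemma alg_homs_id: "id \<in> alg_homs A A"
  by (rule alg_homsI) (auto simp: linear_maps_id)

text \<open>The zero vector is not a separate rule: it arises as \<open>0 \<odot> x\<close> as soon as \<open>X\<close> is nonempty, and all
  spanning sets below contain the unit.\<close>

inductive_set lin_span for A (structure) and X where
  span_base: "x \<in> X \<Longrightarrow> x \<in> lin_span A X"
| span_add: "\<lbrakk>x \<in> lin_span A X; y \<in> lin_span A X\<rbrakk> \<Longrightarrow> x \<oplus> y \<in> lin_span A X"
| span_smult: "x \<in> lin_span A X \<Longrightarrow> c \<odot> x \<in> lin_span A X"

lemma (in complex_algebra) lin_span_subset: "X \<subseteq> carrier A \<Longrightarrow> lin_span A X \<subseteq> carrier A"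
proof
  fix x assume X: "X \<subseteq> carrier A" and "x \<in> lin_span A X"
  from this(2) show "x \<in> carrier A" by induction (use X in auto)
qed

lemma linear_maps_eq_on_span:
  assumes "complex_algebra A" and X: "X \<subseteq> carrier A" "lin_span A X = carrier A"
    and f: "f \<in> linear_maps A B" and g: "g \<in> linear_maps A B"
    and eq: "\<And>x. x \<in> X \<Longrightarrow> f x = g x" and "x \<in> carrier A"
  shows "f x = g x"
proof -
  from \<open>x \<in> carrier A\<close> have "x \<in> lin_span A X" by (simp add: X)
  then show ?thesis
    by induction (auto simp: eq X linear_mapsD[OF f] linear_mapsD[OF g])
qed

text \<open>Both sides of \<open>f (x \<otimes> y) = f x \<otimes> f y\<close> are bilinear, so spanning vectors are enough; the two
  arguments are extended one after the other.\<close>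

lemma alg_homs_on_span:
  assumes "complex_algebra A" "complex_algebra B" and X: "X \<subseteq> carrier A" "lin_span A X = carrier A"
    and f: "f \<in> linear_maps A B" "f \<one>\<^bsub>A\<^esub> = \<one>\<^bsub>B\<^esub>"
    and mult: "\<And>x y. \<lbrakk>x \<in> X; y \<in> X\<rbrakk> \<Longrightarrow> f (x \<otimes>\<^bsub>A\<^esub> y) = f x \<otimes>\<^bsub>B\<^esub> f y"
  shows "f \<in> alg_homs A B"
proof (rule alg_homsI[OF f])
  interpret A: complex_algebra A by fact
  interpret B: complex_algebra B by fact
  note fD = linear_mapsD[OF f(1)]
  have left: "f (x \<otimes>\<^bsub>A\<^esub> y) = f x \<otimes>\<^bsub>B\<^esub> f y" if "x \<in> X" "y \<in> carrier A" for x y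
  proof -
    from that have "y \<in> lin_span A X" by (simp add: X)
    then show ?thesis
      using that(1) X
      by induction (auto simp: mult A.r_distr B.r_distr fD A.smult_mult_right B.smult_mult_right subsetD)
  qed
  fix x y assume "x \<in> carrier A" and y: "y \<in> carrier A"
  from this(1) have "x \<in> lin_span A X" by (simp add: X)
  then show "f (x \<otimes>\<^bsub>A\<^esub> y) = f x \<otimes>\<^bsub>B\<^esub> f y"
    using y X
    by induction (auto simp: left A.l_distr B.l_distr fD A.smult_mult_left B.smult_mult_left subsetD)
qed

text \<open>For \<open>B\<close> only the operations are given. All axioms are equations or existence statements, and so pass to
  the image. This gives the algebra laws in quotients without any computation with cosets.\<close>

lemma complex_algebra_image:
  assumes "complex_algebra A" and im: "f ` carrier A = carrier B"
    and add: "\<And>x y. \<lbrakk>x \<in> carrier A; y \<in> carrier A\<rbrakk> \<Longrightarrow> f (x \<oplus>\<^bsub>A\<^esub> y) = f x \<oplus>\<^bsub>B\<^esub> f y"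
    and mult: "\<And>x y. \<lbrakk>x \<in> carrier A; y \<in> carrier A\<rbrakk> \<Longrightarrow> f (x \<otimes>\<^bsub>A\<^esub> y) = f x \<otimes>\<^bsub>B\<^esub> f y"
    and smult: "\<And>c x. x \<in> carrier A \<Longrightarrow> f (c \<odot>\<^bsub>A\<^esub> x) = c \<odot>\<^bsub>B\<^esub> f x"
    and one: "f \<one>\<^bsub>A\<^esub> = \<one>\<^bsub>B\<^esub>" and zero: "f \<zero>\<^bsub>A\<^esub> = \<zero>\<^bsub>B\<^esub>"
  shows "complex_algebra B"
proof -
  interpret A: complex_algebra A by fact
  have mem: "f x \<in> carrier B" if "x \<in> carrier A" for x using that im by blast
  note op_of_image = add[symmetric] mult[symmetric] smult[symmetric] one[symmetric] zero[symmetric]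
  have "abelian_group B"
  proof (rule abelian_groupI)
    fix x assume "x \<in> carrier B"
    then obtain a where "a \<in> carrier A" "x = f a" using im by blast
    then show "\<exists>y\<in>carrier B. y \<oplus>\<^bsub>B\<^esub> x = \<zero>\<^bsub>B\<^esub>"
      by (intro bexI[of _ "f (\<ominus>\<^bsub>A\<^esub> a)"]) (simp_all add: op_of_image mem A.l_neg)
  qed (auto simp: im[symmetric] op_of_image A.a_ac)
  moreover have "Group.monoid B"
    by (rule monoidI) (auto simp: im[symmetric] op_of_image A.m_assoc)
  ultimately have "ring B"
    by (rule ringI) (auto simp: im[symmetric] op_of_image A.l_distr A.r_distr)
  then show ?thesis
    by (rule complex_algebraI)
       (auto simp: im[symmetric] op_of_image A.smult_add_left A.smult_add_right A.smult_smult
          A.smult_mult_left A.smult_mult_right)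
qed

section \<open>Monoid algebras\<close>

text \<open>The linear extension of \<open>\<phi>\<close> from a basis, in the form in which it occurs inside \<open>tensor_lift\<close>.\<close>

definition lin_ext ::
    "(complex, 'v, 'k) module_scheme \<Rightarrow> ('a \<Rightarrow> 'v) \<Rightarrow> ('a \<Rightarrow>\<^sub>0 complex) \<Rightarrow> 'v" where
  "lin_ext V \<phi> x = (\<Oplus>\<^bsub>V\<^esub>p\<in>Poly_Mapping.keys x. Poly_Mapping.lookup x p \<odot>\<^bsub>V\<^esub> \<phi> p)"

lemma monoid_algebra_simps [simp]:
  "carrier (monoid_algebra G) = {f. Poly_Mapping.keys f \<subseteq> carrier G}"
  "\<one>\<^bsub>monoid_algebra G\<^esub> = Poly_Mapping.single \<one>\<^bsub>G\<^esub> 1"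
  "\<zero>\<^bsub>monoid_algebra G\<^esub> = 0"
  "f \<oplus>\<^bsub>monoid_algebra G\<^esub> g = f + g"
  "c \<odot>\<^bsub>monoid_algebra G\<^esub> f = Poly_Mapping.map ((*) c) f"
  by (simp_all add: monoid_algebra_def)

lemma lookup_scale [simp]:
  "Poly_Mapping.lookup (Poly_Mapping.map ((*) c) f) x = c * Poly_Mapping.lookup f x"
  for c :: complex
  by (simp add: Poly_Mapping.map.rep_eq when_def)

lemma keys_scale_subset: "Poly_Mapping.keys (Poly_Mapping.map ((*) c) f) \<subseteq> Poly_Mapping.keys f"
  for c :: complex
  by (auto simp: in_keys_iff)

lemma scale_single [simp]:
  "Poly_Mapping.map ((*) c) (Poly_Mapping.single x b) = Poly_Mapping.single x (c * b)"
  for c :: complex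
  by (rule poly_mapping_eqI) (simp add: lookup_single when_def)

lemma scale_add:
  "Poly_Mapping.map ((*) c) (f + g) = Poly_Mapping.map ((*) c) f + Poly_Mapping.map ((*) c) g"
  for c :: complex
  by (rule poly_mapping_eqI) (simp add: lookup_add algebra_simps)

lemma scale_minus1: "Poly_Mapping.map ((*) (-1)) f = - f" for f :: "'g \<Rightarrow>\<^sub>0 complex"
  by (rule poly_mapping_eqI) simp

text \<open>A sum of monomials is built up key by key. The set of keys must be nonempty because the zero vector
  is obtained as a monomial with coefficient \<open>0\<close>.\<close>

lemma free_induct [consumes 2, case_names single add]:
  fixes f :: "'g \<Rightarrow>\<^sub>0 complex"
  assumes "Poly_Mapping.keys f \<subseteq> X" "X \<noteq> {}"
    and single: "\<And>x c. x \<in> X \<Longrightarrow> P (Poly_Mapping.single x c)"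
    and add: "\<And>f g. \<lbrakk>Poly_Mapping.keys f \<subseteq> X; Poly_Mapping.keys g \<subseteq> X; P f; P g\<rbrakk> \<Longrightarrow> P (f + g)"
  shows "P f"
proof -
  from \<open>X \<noteq> {}\<close> obtain x0 where "x0 \<in> X" by blast
  then have zero: "P 0" using single[of x0 0] by simp
  have fin: "finite K \<Longrightarrow> K \<subseteq> X \<Longrightarrow> \<forall>f. Poly_Mapping.keys f \<subseteq> K \<longrightarrow> P f" for K
  proof (induction K rule: finite_induct)
    case empty
    then show ?case using zero by (metis keys_eq_empty subset_empty)
  next
    case (insert k K)
    show ?case
    proof (intro allI impI)
      fix f :: "'g \<Rightarrow>\<^sub>0 complex" assume f: "Poly_Mapping.keys f \<subseteq> insert k K"
      define g where "g = f - Poly_Mapping.single k (Poly_Mapping.lookup f k)"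
      have g: "Poly_Mapping.keys g \<subseteq> K"
        using f by (auto simp: g_def in_keys_iff lookup_minus lookup_single when_def split: if_splits)
      have "f = Poly_Mapping.single k (Poly_Mapping.lookup f k) + g" by (simp add: g_def)
      moreover have "P (Poly_Mapping.single k (Poly_Mapping.lookup f k) + g)"
        using insert g by (intro add single) auto
      ultimately show "P f" by simp
    qed
  qed
  show ?thesis using fin[OF finite_keys assms(1)] by simp
qed

text \<open>Summing over a larger set than the support adds only zeros. Two vectors with different supports can
  therefore be compared over a common set of keys.\<close>

lemma lin_ext_eq_finsum:
  fixes V (structure)
  assumes "Module.module complexes V" "finite K" "Poly_Mapping.keys x \<subseteq> K" "\<phi> \<in> K \<rightarrow> carrier V"
  shows "lin_ext V \<phi> x = (\<Oplus>p\<in>K. Poly_Mapping.lookup x p \<odot> \<phi> p)"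
proof -
  interpret V: Module.module complexes V by fact
  show ?thesis unfolding lin_ext_def
  proof (rule V.M.add.finprod_mono_neutral_cong_left)
    fix i assume "i \<in> K - Poly_Mapping.keys x"
    then show "Poly_Mapping.lookup x i \<odot> \<phi> i = \<zero>"
      using assms V.smult_l_null[of "\<phi> i"] by (auto simp: in_keys_iff)
  qed (use assms in auto)
qed

lemma lin_ext_single:
  assumes "Module.module complexes V" "\<phi> x \<in> carrier V"
  shows "lin_ext V \<phi> (Poly_Mapping.single x c) = c \<odot>\<^bsub>V\<^esub> \<phi> x"
proof -
  interpret V: Module.module complexes V by fact
  have "lin_ext V \<phi> (Poly_Mapping.single x c)
      = (\<Oplus>\<^bsub>V\<^esub>p\<in>{x}. Poly_Mapping.lookup (Poly_Mapping.single x c) p \<odot>\<^bsub>V\<^esub> \<phi> p)"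
    by (rule lin_ext_eq_finsum) (use assms in auto)
  then show ?thesis using assms by (simp add: V.M.finsum_insert)
qed

lemma lin_ext_linear:
  assumes "Module.module complexes V" "\<phi> \<in> carrier G \<rightarrow> carrier V"
  shows "lin_ext V \<phi> \<in> linear_maps (monoid_algebra G) V"
proof -
  interpret V: Module.module complexes V by fact
  show ?thesis
  proof (rule linear_mapsI)
    fix x assume x: "x \<in> carrier (monoid_algebra G)"
    then have "\<phi> \<in> Poly_Mapping.keys x \<rightarrow> carrier V" using assms(2) by auto
    then show "lin_ext V \<phi> x \<in> carrier V"
      unfolding lin_ext_def by (intro V.M.finsum_closed) auto
    fix y assume y: "y \<in> carrier (monoid_algebra G)"
    let ?K = "Poly_Mapping.keys x \<union> Poly_Mapping.keys y"
    have K: "\<phi> \<in> ?K \<rightarrow> carrier V" using x y assms(2) by auto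
    have KV: "\<phi> p \<in> carrier V" if "p \<in> ?K" for p using K that by blast
    have "lin_ext V \<phi> (x + y) = (\<Oplus>\<^bsub>V\<^esub>p\<in>?K. Poly_Mapping.lookup (x + y) p \<odot>\<^bsub>V\<^esub> \<phi> p)"
      by (rule lin_ext_eq_finsum) (use assms K in \<open>auto simp: in_keys_iff lookup_add\<close>)
    also have "\<dots> = (\<Oplus>\<^bsub>V\<^esub>p\<in>?K. Poly_Mapping.lookup x p \<odot>\<^bsub>V\<^esub> \<phi> p \<oplus>\<^bsub>V\<^esub> Poly_Mapping.lookup y p \<odot>\<^bsub>V\<^esub> \<phi> p)"
    proof (rule V.M.finsum_cong')
      fix p assume "p \<in> ?K"
      then show "Poly_Mapping.lookup (x + y) p \<odot>\<^bsub>V\<^esub> \<phi> p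
          = Poly_Mapping.lookup x p \<odot>\<^bsub>V\<^esub> \<phi> p \<oplus>\<^bsub>V\<^esub> Poly_Mapping.lookup y p \<odot>\<^bsub>V\<^esub> \<phi> p"
        using K V.smult_l_distr[of "Poly_Mapping.lookup x p" "Poly_Mapping.lookup y p" "\<phi> p"]
        by (auto simp: lookup_add)
    qed (use KV in auto)
    also have "\<dots> = lin_ext V \<phi> x \<oplus>\<^bsub>V\<^esub> lin_ext V \<phi> y"
      using KV by (subst V.M.finsum_addf)
        (auto simp: lin_ext_eq_finsum[OF assms(1), of ?K x] lin_ext_eq_finsum[OF assms(1), of ?K y])
    finally show "lin_ext V \<phi> (x \<oplus>\<^bsub>monoid_algebra G\<^esub> y) = lin_ext V \<phi> x \<oplus>\<^bsub>V\<^esub> lin_ext V \<phi> y" by simp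
  next
    fix c x assume x: "x \<in> carrier (monoid_algebra G)"
    let ?K = "Poly_Mapping.keys x"
    have K: "\<phi> \<in> ?K \<rightarrow> carrier V" using x assms(2) by auto
    have KV: "\<phi> p \<in> carrier V" if "p \<in> ?K" for p using K that by blast
    have "lin_ext V \<phi> (Poly_Mapping.map ((*) c) x)
        = (\<Oplus>\<^bsub>V\<^esub>p\<in>?K. Poly_Mapping.lookup (Poly_Mapping.map ((*) c) x) p \<odot>\<^bsub>V\<^esub> \<phi> p)"
      by (rule lin_ext_eq_finsum[OF assms(1) _ keys_scale_subset K]) simp
    also have "\<dots> = (\<Oplus>\<^bsub>V\<^esub>p\<in>?K. c \<odot>\<^bsub>V\<^esub> (Poly_Mapping.lookup x p \<odot>\<^bsub>V\<^esub> \<phi> p))"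
    proof (rule V.M.finsum_cong')
      fix p assume "p \<in> ?K"
      then show "Poly_Mapping.lookup (Poly_Mapping.map ((*) c) x) p \<odot>\<^bsub>V\<^esub> \<phi> p
          = c \<odot>\<^bsub>V\<^esub> (Poly_Mapping.lookup x p \<odot>\<^bsub>V\<^esub> \<phi> p)"
        using K V.smult_assoc1[of c "Poly_Mapping.lookup x p" "\<phi> p"] by auto
    qed (use KV in auto)
    also have "\<dots> = c \<odot>\<^bsub>V\<^esub> lin_ext V \<phi> x"
      unfolding lin_ext_def using KV by (subst V.finsum_smult_ldistr) auto
    finally show "lin_ext V \<phi> (c \<odot>\<^bsub>monoid_algebra G\<^esub> x) = c \<odot>\<^bsub>V\<^esub> lin_ext V \<phi> x" by simp
  qed
qed

text \<open>As for linear extensions, larger index sets are harmless; this makes the product visibly bilinear.\<close>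

lemma monoid_algebra_mult:
  assumes "finite K" "Poly_Mapping.keys f \<subseteq> K" "finite L" "Poly_Mapping.keys g \<subseteq> L"
  shows "f \<otimes>\<^bsub>monoid_algebra G\<^esub> g =
    (\<Sum>x\<in>K. \<Sum>y\<in>L. Poly_Mapping.single (x \<otimes>\<^bsub>G\<^esub> y) (Poly_Mapping.lookup f x * Poly_Mapping.lookup g y))"
proof -
  have "f \<otimes>\<^bsub>monoid_algebra G\<^esub> g =
    (\<Sum>x\<in>Poly_Mapping.keys f. \<Sum>y\<in>L. Poly_Mapping.single (x \<otimes>\<^bsub>G\<^esub> y) (Poly_Mapping.lookup f x * Poly_Mapping.lookup g y))"
    unfolding monoid_algebra_def using assms
    by (simp, intro sum.cong[OF refl] sum.mono_neutral_left) (auto simp: in_keys_iff)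
  also have "\<dots> = (\<Sum>x\<in>K. \<Sum>y\<in>L. Poly_Mapping.single (x \<otimes>\<^bsub>G\<^esub> y) (Poly_Mapping.lookup f x * Poly_Mapping.lookup g y))"
    using assms by (intro sum.mono_neutral_left) (auto simp: in_keys_iff)
  finally show ?thesis .
qed

lemma monoid_algebra_mult_single [simp]:
  "Poly_Mapping.single x a \<otimes>\<^bsub>monoid_algebra G\<^esub> Poly_Mapping.single y b
    = Poly_Mapping.single (x \<otimes>\<^bsub>G\<^esub> y) (a * b)"
  by (subst monoid_algebra_mult[of "{x}" _ "{y}"]) (auto simp: in_keys_iff lookup_single when_def)

lemma monoid_algebra_mult_distrib:
  shows monoid_algebra_mult_add_left:
      "(f + f') \<otimes>\<^bsub>monoid_algebra G\<^esub> g = f \<otimes>\<^bsub>monoid_algebra G\<^esub> g + f' \<otimes>\<^bsub>monoid_algebra G\<^esub> g"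
    and monoid_algebra_mult_add_right:
      "g \<otimes>\<^bsub>monoid_algebra G\<^esub> (f + f') = g \<otimes>\<^bsub>monoid_algebra G\<^esub> f + g \<otimes>\<^bsub>monoid_algebra G\<^esub> f'"
proof -
  let ?K = "Poly_Mapping.keys f \<union> Poly_Mapping.keys f'" and ?L = "Poly_Mapping.keys g"
  have K: "finite ?K" "Poly_Mapping.keys f \<subseteq> ?K" "Poly_Mapping.keys f' \<subseteq> ?K"
      "Poly_Mapping.keys (f + f') \<subseteq> ?K"
    by (auto simp: in_keys_iff lookup_add)
  show "(f + f') \<otimes>\<^bsub>monoid_algebra G\<^esub> g = f \<otimes>\<^bsub>monoid_algebra G\<^esub> g + f' \<otimes>\<^bsub>monoid_algebra G\<^esub> g"
    using K by (simp add: monoid_algebra_mult[of ?K _ ?L] lookup_add distrib_right single_add sum.distrib)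
  show "g \<otimes>\<^bsub>monoid_algebra G\<^esub> (f + f') = g \<otimes>\<^bsub>monoid_algebra G\<^esub> f + g \<otimes>\<^bsub>monoid_algebra G\<^esub> f'"
    using K by (simp add: monoid_algebra_mult[of ?L _ ?K] lookup_add distrib_left single_add sum.distrib)
qed

lemma complex_algebra_monoid_algebra:
  assumes "Group.monoid G"
  shows "complex_algebra (monoid_algebra G)"
proof -
  interpret G: Group.monoid G by fact
  let ?A = "monoid_algebra G"
  have ne: "carrier G \<noteq> {}" using G.one_closed by blast
  have add_in: "f + g \<in> carrier ?A" if "f \<in> carrier ?A" "g \<in> carrier ?A" for f g
    using that keys_add[of f g] by auto
  note distribs = monoid_algebra_mult_distrib scale_add
  have closed: "f \<otimes>\<^bsub>?A\<^esub> g \<in> carrier ?A" if "f \<in> carrier ?A" "g \<in> carrier ?A" for f g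
  proof -
    have f: "Poly_Mapping.keys f \<subseteq> carrier G" and g: "Poly_Mapping.keys g \<subseteq> carrier G"
      using that by auto
    from f ne show ?thesis
    proof (induction f rule: free_induct)
      case (single x c)
      from g ne show ?case
      proof (induction g rule: free_induct)
        case (add f g)
        then show ?case unfolding distribs by (intro add_in)
      qed (use single in auto)
    next
      case (add f g)
      then show ?case unfolding distribs by (intro add_in)
    qed
  qed
  have assoc: "(f \<otimes>\<^bsub>?A\<^esub> g) \<otimes>\<^bsub>?A\<^esub> h = f \<otimes>\<^bsub>?A\<^esub> (g \<otimes>\<^bsub>?A\<^esub> h)"
    if "f \<in> carrier ?A" "g \<in> carrier ?A" "h \<in> carrier ?A" for f g h
  proof -
    have f: "Poly_Mapping.keys f \<subseteq> carrier G" and g: "Poly_Mapping.keys g \<subseteq> carrier G"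
      and h: "Poly_Mapping.keys h \<subseteq> carrier G" using that by auto
    from f ne show ?thesis
    proof (induction f rule: free_induct)
      case (single x a)
      note x = single
      from g ne show ?case
      proof (induction g rule: free_induct)
        case (single y b)
        note y = single
        from h ne show ?case
          by (induction h rule: free_induct)
            (use x y in \<open>simp_all add: distribs G.m_assoc mult.assoc\<close>)
      qed (simp add: distribs)
    qed (simp add: distribs)
  qed
  have unit: "\<one>\<^bsub>?A\<^esub> \<otimes>\<^bsub>?A\<^esub> f = f" "f \<otimes>\<^bsub>?A\<^esub> \<one>\<^bsub>?A\<^esub> = f" if "f \<in> carrier ?A" for f
  proof -
    have "Poly_Mapping.keys f \<subseteq> carrier G" using that by auto
    from this ne have "\<one>\<^bsub>?A\<^esub> \<otimes>\<^bsub>?A\<^esub> f = f \<and> f \<otimes>\<^bsub>?A\<^esub> \<one>\<^bsub>?A\<^esub> = f"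
      by (induction f rule: free_induct) (simp_all add: distribs)
    then show "\<one>\<^bsub>?A\<^esub> \<otimes>\<^bsub>?A\<^esub> f = f" "f \<otimes>\<^bsub>?A\<^esub> \<one>\<^bsub>?A\<^esub> = f" by auto
  qed
  have scale: "(c \<odot>\<^bsub>?A\<^esub> f) \<otimes>\<^bsub>?A\<^esub> g = c \<odot>\<^bsub>?A\<^esub> (f \<otimes>\<^bsub>?A\<^esub> g) \<and> f \<otimes>\<^bsub>?A\<^esub> (c \<odot>\<^bsub>?A\<^esub> g) = c \<odot>\<^bsub>?A\<^esub> (f \<otimes>\<^bsub>?A\<^esub> g)"
    if "f \<in> carrier ?A" "g \<in> carrier ?A" for f g c
  proof -
    have f: "Poly_Mapping.keys f \<subseteq> carrier G" and g: "Poly_Mapping.keys g \<subseteq> carrier G"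
      using that by auto
    from f ne show ?thesis
    proof (induction f rule: free_induct)
      case (single x b)
      from g ne show ?case
        by (induction g rule: free_induct) (simp_all add: distribs mult.assoc mult.left_commute)
    qed (simp add: distribs)
  qed
  have "abelian_group ?A"
  proof (rule abelian_groupI)
    fix x assume "x \<in> carrier ?A"
    then show "\<exists>y\<in>carrier ?A. y \<oplus>\<^bsub>?A\<^esub> x = \<zero>\<^bsub>?A\<^esub>"
      by (intro bexI[of _ "- x"]) (auto simp: in_keys_iff)
  qed (simp_all add: algebra_simps add_in[simplified])
  moreover have "Group.monoid ?A"
    using closed unit assoc by (intro monoidI) (simp_all add: G.one_closed)
  ultimately have "ring ?A"
    by (rule ringI) (simp_all add: distribs)
  then show ?thesis
  proof (rule complex_algebraI)
    fix c and x assume "x \<in> carrier ?A"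
    then show "c \<odot>\<^bsub>?A\<^esub> x \<in> carrier ?A" using keys_scale_subset[of c x] by auto
  qed (use scale in \<open>auto simp: scale_add lookup_add algebra_simps intro!: poly_mapping_eqI\<close>)
qed

lemma monoid_algebra_span:
  assumes "Group.monoid G"
  shows "lin_span (monoid_algebra G) ((\<lambda>x. Poly_Mapping.single x 1) ` carrier G)
    = carrier (monoid_algebra G)" (is "lin_span ?A ?X = _")
proof
  interpret G: Group.monoid G by fact
  interpret A: complex_algebra ?A by (rule complex_algebra_monoid_algebra) fact
  show "lin_span ?A ?X \<subseteq> carrier ?A" by (rule A.lin_span_subset) auto
  show "carrier ?A \<subseteq> lin_span ?A ?X"
  proof
    fix f assume "f \<in> carrier ?A"
    then have "Poly_Mapping.keys f \<subseteq> carrier G" "carrier G \<noteq> {}" using G.one_closed by auto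
    then show "f \<in> lin_span ?A ?X"
    proof (induction f rule: free_induct)
      case (single x c)
      then have "c \<odot>\<^bsub>?A\<^esub> Poly_Mapping.single x 1 \<in> lin_span ?A ?X"
        by (intro lin_span.intros) auto
      then show ?case by simp
    next
      case (add f g)
      then show ?case using lin_span.span_add[of f ?A ?X g] by simp
    qed
  qed
qed

text \<open>Universal property: a monoid homomorphism into the multiplicative monoid of \<open>B\<close> extends to an algebra
  homomorphism.\<close>

lemma monoid_algebra_lift:
  assumes "Group.monoid G" "complex_algebra B" "\<phi> \<in> carrier G \<rightarrow> carrier B" "\<phi> \<one>\<^bsub>G\<^esub> = \<one>\<^bsub>B\<^esub>"
    and "\<And>x y. \<lbrakk>x \<in> carrier G; y \<in> carrier G\<rbrakk> \<Longrightarrow> \<phi> (x \<otimes>\<^bsub>G\<^esub> y) = \<phi> x \<otimes>\<^bsub>B\<^esub> \<phi> y"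
  shows "lin_ext B \<phi> \<in> alg_homs (monoid_algebra G) B"
proof (rule alg_homs_on_span[OF complex_algebra_monoid_algebra[OF assms(1)] assms(2)])
  interpret G: Group.monoid G by fact
  interpret B: complex_algebra B by fact
  have in_B: "\<phi> x \<in> carrier B" if "x \<in> carrier G" for x using assms(3) that by blast
  have single: "lin_ext B \<phi> (Poly_Mapping.single x 1) = \<phi> x" if "x \<in> carrier G" for x
    using lin_ext_single[OF B.vector_space, of \<phi> x 1] in_B that by simp
  show "lin_ext B \<phi> \<in> linear_maps (monoid_algebra G) B"
    by (rule lin_ext_linear[OF B.vector_space assms(3)])
  show "lin_ext B \<phi> \<one>\<^bsub>monoid_algebra G\<^esub> = \<one>\<^bsub>B\<^esub>"
    using assms(4) by (simp add: single)
  show "lin_span (monoid_algebra G) ((\<lambda>x. Poly_Mapping.single x 1) ` carrier G)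
    = carrier (monoid_algebra G)"
    by (rule monoid_algebra_span[OF assms(1)])
  fix x y assume "x \<in> (\<lambda>x. Poly_Mapping.single x (1::complex)) ` carrier G"
    "y \<in> (\<lambda>x. Poly_Mapping.single x (1::complex)) ` carrier G"
  then obtain a b where "a \<in> carrier G" "b \<in> carrier G"
    "x = Poly_Mapping.single a 1" "y = Poly_Mapping.single b 1" by blast
  then show "lin_ext B \<phi> (x \<otimes>\<^bsub>monoid_algebra G\<^esub> y) = lin_ext B \<phi> x \<otimes>\<^bsub>B\<^esub> lin_ext B \<phi> y"
    by (simp add: single assms(5))
qed auto

context complex_algebra
begin

lemma left_mult_linear: "a \<in> carrier A \<Longrightarrow> (\<lambda>x. a \<otimes> x) \<in> linear_maps A A"
  by (rule linear_mapsI) (simp_all add: r_distr smult_mult_right)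

lemma right_mult_linear: "a \<in> carrier A \<Longrightarrow> (\<lambda>x. x \<otimes> a) \<in> linear_maps A A"
  by (rule linear_mapsI) (simp_all add: l_distr smult_mult_left)

end

section \<open>Quotient algebras\<close>

lemma quot_algebra_simps:
  "carrier (quot_algebra A I) = (+>\<^bsub>A\<^esub>) I ` carrier A"
  "X \<otimes>\<^bsub>quot_algebra A I\<^esub> Y = rcoset_mult A I X Y"
  "\<one>\<^bsub>quot_algebra A I\<^esub> = I +>\<^bsub>A\<^esub> \<one>\<^bsub>A\<^esub>"
  "\<zero>\<^bsub>quot_algebra A I\<^esub> = I"
  "X \<oplus>\<^bsub>quot_algebra A I\<^esub> Y = X <+>\<^bsub>A\<^esub> Y"
  "c \<odot>\<^bsub>quot_algebra A I\<^esub> X = (\<Union>x\<in>X. I +>\<^bsub>A\<^esub> (c \<odot>\<^bsub>A\<^esub> x))"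
  by (auto simp: quot_algebra_def FactRing_def ring.defs module.defs A_RCOSETS_defs a_r_coset_def)

locale algebra_ideal = complex_algebra A + ideal I A for A (structure) and I
begin

text \<open>Ring ideals are closed under scalars because \<open>c \<odot> x = (c \<odot> \<one>) \<otimes> x\<close>.\<close>

lemma smult_ideal: "x \<in> I \<Longrightarrow> c \<odot> x \<in> I"
  using I_l_closed[of x "c \<odot> \<one>"] by (simp add: smult_mult_left a_Hcarr)

lemma coset_smult:
  assumes "x \<in> carrier A"
  shows "c \<odot>\<^bsub>quot_algebra A I\<^esub> (I +> x) = I +> (c \<odot> x)"
proof -
  have "I +> (c \<odot> y) = I +> (c \<odot> x)" if "y \<in> I +> x" for y
  proof -
    from that obtain h where h: "h \<in> I" and y: "y = h \<oplus> x"
      by (auto simp: a_r_coset_def')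
    have "c \<odot> y \<in> I +> (c \<odot> x)"
      using h assms smult_ideal[OF h, of c] by (auto simp: y smult_add_right a_Hcarr a_r_coset_def')
    then show ?thesis using a_repr_independence' assms by auto
  qed
  then have "(\<Union>y\<in>I +> x. I +> (c \<odot> y)) = (\<Union>y\<in>I +> x. I +> (c \<odot> x))"
    by (intro SUP_cong) auto
  also have "\<dots> = I +> (c \<odot> x)" using a_rcos_self[OF assms] by blast
  finally show ?thesis by (simp only: quot_algebra_simps)
qed

lemma complex_algebra_quot: "complex_algebra (quot_algebra A I)"
  by (rule complex_algebra_image[where A = A and f = "(+>) I"])
     (unfold_locales, simp_all add: quot_algebra_simps(1-5) coset_smult rcoset_mult_add a_rcos_sum a_rcos_const)

lemma coset_alg_hom: "(+>) I \<in> alg_homs A (quot_algebra A I)"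
  by (intro alg_homsI linear_mapsI)
     (simp_all add: quot_algebra_simps(1-5) coset_smult rcoset_mult_add a_rcos_sum)

lemma coset_eqI: "\<lbrakk>x \<in> carrier A; y \<in> carrier A; x \<ominus> y \<in> I\<rbrakk> \<Longrightarrow> I +> x = I +> y"
  using quotient_eq_iff_same_a_r_cos[OF is_ideal] by simp

text \<open>A linear map vanishing on \<open>I\<close> is constant on cosets, so the image of a coset is a singleton and
  \<open>the_elem\<close> picks the induced value.\<close>

lemma quot_lift_coset:
  assumes V: "complex_algebra V" and f: "f \<in> linear_maps A V" and ker: "\<And>x. x \<in> I \<Longrightarrow> f x = \<zero>\<^bsub>V\<^esub>"
    and x: "x \<in> carrier A"
  shows "the_elem (f ` (I +> x)) = f x"
proof -
  interpret V: complex_algebra V by fact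
  have "f (h \<oplus> x) = f x" if "h \<in> I" for h
    using that x linear_mapsD[OF f] by (simp add: ker a_Hcarr)
  moreover have "I +> x = (\<lambda>h. h \<oplus> x) ` I" by (auto simp: a_r_coset_def')
  moreover have "I \<noteq> {}"
    using additive_subgroup.zero_closed[OF is_additive_subgroup] by blast
  ultimately have "f ` (I +> x) = (\<lambda>h. f x) ` I" by (simp add: image_image)
  then have "f ` (I +> x) = {f x}" using \<open>I \<noteq> {}\<close> by auto
  then show ?thesis by simp
qed

lemma quot_lift_linear:
  assumes V: "complex_algebra V" and f: "f \<in> linear_maps A V" and ker: "\<And>x. x \<in> I \<Longrightarrow> f x = \<zero>\<^bsub>V\<^esub>"
  shows "(\<lambda>X. the_elem (f ` X)) \<in> linear_maps (quot_algebra A I) V"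
proof (rule linear_mapsI)
  note proj = linear_mapsD(2,3)[OF alg_homsD(1)[OF coset_alg_hom], symmetric]
  note lift = quot_lift_coset[OF assms]
  fix X assume "X \<in> carrier (quot_algebra A I)"
  then obtain x where x: "X = I +> x" "x \<in> carrier A" by (auto simp: quot_algebra_simps)
  then show "the_elem (f ` X) \<in> carrier V" using lift linear_mapsD[OF f] by simp
  show "the_elem (f ` (c \<odot>\<^bsub>quot_algebra A I\<^esub> X)) = c \<odot>\<^bsub>V\<^esub> the_elem (f ` X)" for c
    using x lift linear_mapsD[OF f] by (simp add: proj)
  fix Y assume "Y \<in> carrier (quot_algebra A I)"
  then obtain y where y: "Y = I +> y" "y \<in> carrier A" by (auto simp: quot_algebra_simps)
  show "the_elem (f ` (X \<oplus>\<^bsub>quot_algebra A I\<^esub> Y)) = the_elem (f ` X) \<oplus>\<^bsub>V\<^esub> the_elem (f ` Y)"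
    using x y lift linear_mapsD[OF f] by (simp add: proj)
qed

lemma quot_lift_alg_hom:
  assumes V: "complex_algebra V" and f: "f \<in> alg_homs A V" and ker: "\<And>x. x \<in> I \<Longrightarrow> f x = \<zero>\<^bsub>V\<^esub>"
  shows "(\<lambda>X. the_elem (f ` X)) \<in> alg_homs (quot_algebra A I) V"
proof (rule alg_homsI)
  note proj = alg_homsD(2,3)[OF coset_alg_hom, symmetric]
  note lift = quot_lift_coset[OF V alg_homsD(1)[OF f] ker]
  show "(\<lambda>X. the_elem (f ` X)) \<in> linear_maps (quot_algebra A I) V"
    by (rule quot_lift_linear[OF V alg_homsD(1)[OF f] ker])
  show "the_elem (f ` \<one>\<^bsub>quot_algebra A I\<^esub>) = \<one>\<^bsub>V\<^esub>"
    using lift[OF _ one_closed] alg_homsD(2)[OF f] by (simp add: quot_algebra_simps)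
  fix X Y assume "X \<in> carrier (quot_algebra A I)" "Y \<in> carrier (quot_algebra A I)"
  then obtain x y where "X = I +> x" "x \<in> carrier A" "Y = I +> y" "y \<in> carrier A"
    by (auto simp: quot_algebra_simps)
  then show "the_elem (f ` (X \<otimes>\<^bsub>quot_algebra A I\<^esub> Y)) = the_elem (f ` X) \<otimes>\<^bsub>V\<^esub> the_elem (f ` Y)"
    using lift alg_homsD(3)[OF f] by (simp add: proj)
qed

end

section \<open>Tensor products\<close>

lemma submodule_zero_mem: "submodule K R M \<Longrightarrow> \<zero>\<^bsub>M\<^esub> \<in> K"
  using subgroup.one_closed[of K "add_monoid M"] by (simp add: submodule_def)

text \<open>Used to show that \<open>tensor_null\<close>, the least submodule containing the relators, lies in the kernel of a
  linear map or is stable under one: it suffices to look at the relators.\<close>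

lemma (in complex_algebra) submodule_preimage:
  assumes "complex_algebra B" and f: "f \<in> linear_maps A B" and K: "submodule K complexes B"
  shows "submodule {x \<in> carrier A. f x \<in> K} complexes A"
proof -
  interpret B: complex_algebra B by fact
  note sub = B.submoduleE[OF K]
  note fD = linear_mapsD[OF f]
  have zero: "f \<zero> = \<zero>\<^bsub>B\<^esub>" using linear_maps_zero[OF complex_algebra_axioms assms(1) f] .
  show ?thesis
    using sub zero submodule_zero_mem[OF K] by (intro submoduleI) (auto simp: fD smult_minus1[symmetric])
qed

lemma (in complex_algebra) submodule_zero: "submodule {\<zero>} complexes A"
  by (rule submoduleI) auto

definition bilinear_maps ::
    "(complex, 'a, 'm) module_scheme \<Rightarrow> (complex, 'b, 'n) module_scheme
      \<Rightarrow> (complex, 'v, 'k) module_scheme \<Rightarrow> ('a \<times> 'b \<Rightarrow> 'v) set" where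
  "bilinear_maps A B V = {\<phi>.
     (\<forall>a\<in>carrier A. (\<lambda>b. \<phi> (a, b)) \<in> linear_maps B V) \<and>
     (\<forall>b\<in>carrier B. (\<lambda>a. \<phi> (a, b)) \<in> linear_maps A V)}"

lemma bilinear_mapsI:
  assumes "\<And>a. a \<in> carrier A \<Longrightarrow> (\<lambda>b. \<phi> (a, b)) \<in> linear_maps B V"
    and "\<And>b. b \<in> carrier B \<Longrightarrow> (\<lambda>a. \<phi> (a, b)) \<in> linear_maps A V"
  shows "\<phi> \<in> bilinear_maps A B V"
  using assms by (auto simp: bilinear_maps_def)

lemma bilinear_mapsD:
  assumes "\<phi> \<in> bilinear_maps A B V"
  shows "a \<in> carrier A \<Longrightarrow> (\<lambda>b. \<phi> (a, b)) \<in> linear_maps B V"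
    and "b \<in> carrier B \<Longrightarrow> (\<lambda>a. \<phi> (a, b)) \<in> linear_maps A V"
  using assms by (auto simp: bilinear_maps_def)

lemma monoid_algebra_mult_diff:
  "(f - f') \<otimes>\<^bsub>monoid_algebra G\<^esub> g = f \<otimes>\<^bsub>monoid_algebra G\<^esub> g - f' \<otimes>\<^bsub>monoid_algebra G\<^esub> g"
  "g \<otimes>\<^bsub>monoid_algebra G\<^esub> (f - f') = g \<otimes>\<^bsub>monoid_algebra G\<^esub> f - g \<otimes>\<^bsub>monoid_algebra G\<^esub> f'"
  using monoid_algebra_mult_add_left[of G "f - f'" f' g] monoid_algebra_mult_add_right[of G g "f - f'" f']
  by simp_all

lemma monoid_algebra_minus:
  assumes "Group.monoid G" "Poly_Mapping.keys f \<subseteq> carrier G" "Poly_Mapping.keys g \<subseteq> carrier G"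
  shows "f \<ominus>\<^bsub>monoid_algebra G\<^esub> g = f - g"
proof -
  interpret complex_algebra "monoid_algebra G" by (rule complex_algebra_monoid_algebra) fact
  have "\<ominus>\<^bsub>monoid_algebra G\<^esub> g = - g" using smult_minus1[of g] assms by (simp add: scale_minus1)
  then show ?thesis by (simp add: a_minus_def)
qed

lemma keys_diff_in: "\<lbrakk>Poly_Mapping.keys f \<subseteq> X; Poly_Mapping.keys g \<subseteq> X\<rbrakk> \<Longrightarrow> Poly_Mapping.keys (f - g) \<subseteq> X"
  for f g :: "'g \<Rightarrow>\<^sub>0 complex"
  by (rule subset_trans[OF keys_diff]) auto

locale tensor_product = A: complex_algebra A + B: complex_algebra B
  for A :: "(complex, 'a, 'm) module_scheme" and B :: "(complex, 'b, 'n) module_scheme"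
begin

abbreviation F where "F \<equiv> monoid_algebra (A \<times>\<times> B)"
abbreviation N where "N \<equiv> tensor_null A B"
abbreviation T where "T \<equiv> A \<otimes>\<^sub>A B"
abbreviation pure where "pure \<equiv> pure_tensor A B"

lemma monoid_pairs: "Group.monoid (A \<times>\<times> B)"
  by (intro DirProd_monoid) unfold_locales

sublocale F: complex_algebra F
  by (rule complex_algebra_monoid_algebra[OF monoid_pairs])

lemma relators_induct [consumes 1, case_names add_left add_right smult_left smult_right]:
  assumes "r \<in> tensor_relators A B"
    and "\<And>a a' b. \<lbrakk>a \<in> carrier A; a' \<in> carrier A; b \<in> carrier B\<rbrakk> \<Longrightarrow>
      P (Poly_Mapping.single (a \<oplus>\<^bsub>A\<^esub> a', b) 1 - Poly_Mapping.single (a, b) 1 - Poly_Mapping.single (a', b) 1)"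
    and "\<And>a b b'. \<lbrakk>a \<in> carrier A; b \<in> carrier B; b' \<in> carrier B\<rbrakk> \<Longrightarrow>
      P (Poly_Mapping.single (a, b \<oplus>\<^bsub>B\<^esub> b') 1 - Poly_Mapping.single (a, b) 1 - Poly_Mapping.single (a, b') 1)"
    and "\<And>c a b. \<lbrakk>a \<in> carrier A; b \<in> carrier B\<rbrakk> \<Longrightarrow>
      P (Poly_Mapping.single (c \<odot>\<^bsub>A\<^esub> a, b) 1 - Poly_Mapping.single (a, b) c)"
    and "\<And>c a b. \<lbrakk>a \<in> carrier A; b \<in> carrier B\<rbrakk> \<Longrightarrow>
      P (Poly_Mapping.single (a, c \<odot>\<^bsub>B\<^esub> b) 1 - Poly_Mapping.single (a, b) c)"
  shows "P r"
  using assms(1) unfolding tensor_relators_def by (elim UnE CollectE exE conjE) (simp_all add: assms(2-5))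

lemma relators_subset: "tensor_relators A B \<subseteq> carrier F"
proof
  fix r assume "r \<in> tensor_relators A B"
  then show "r \<in> carrier F"
    by (induction r rule: relators_induct) (simp_all add: keys_diff_in)
qed

lemma submodule_null: "submodule N complexes F"
proof -
  have all: "\<And>K. submodule K complexes F \<and> tensor_relators A B \<subseteq> K \<Longrightarrow> N \<subseteq> K"
    unfolding tensor_null_def by blast
  have into: "x \<in> N" if "\<And>K. submodule K complexes F \<Longrightarrow> tensor_relators A B \<subseteq> K \<Longrightarrow> x \<in> K" for x
    using that unfolding tensor_null_def by blast
  show ?thesis
  proof (rule F.submoduleI)
    show "N \<subseteq> carrier F" using all[of "carrier F"] F.carrier_is_submodule relators_subset by blast
    show "\<zero>\<^bsub>F\<^esub> \<in> N"
      by (intro into submodule_zero_mem)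
    show "\<ominus>\<^bsub>F\<^esub> a \<in> N" if "a \<in> N" for a
    proof (rule into)
      fix K assume K: "submodule K complexes F" "tensor_relators A B \<subseteq> K"
      then have "a \<in> K" using that all by blast
      then show "\<ominus>\<^bsub>F\<^esub> a \<in> K" by (rule F.submoduleE(3)[OF K(1)])
    qed
    show "a \<oplus>\<^bsub>F\<^esub> b \<in> N" if "a \<in> N" "b \<in> N" for a b
    proof (rule into)
      fix K assume K: "submodule K complexes F" "tensor_relators A B \<subseteq> K"
      then have "a \<in> K" "b \<in> K" using that all by blast+
      then show "a \<oplus>\<^bsub>F\<^esub> b \<in> K" by (rule F.submoduleE(5)[OF K(1)])
    qed
    show "c \<odot>\<^bsub>F\<^esub> a \<in> N" if "a \<in> N" for c a
    proof (rule into)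
      fix K assume K: "submodule K complexes F" "tensor_relators A B \<subseteq> K"
      then have "a \<in> K" using that all by blast
      then show "c \<odot>\<^bsub>F\<^esub> a \<in> K" by (rule F.submoduleE(4)[OF K(1), rotated]) simp
    qed
  qed
qed

lemma null_least: "\<lbrakk>submodule K complexes F; tensor_relators A B \<subseteq> K\<rbrakk> \<Longrightarrow> N \<subseteq> K"
  unfolding tensor_null_def by blast

lemma relators_null: "tensor_relators A B \<subseteq> N"
  unfolding tensor_null_def by blast

lemma relators_null':
  "\<lbrakk>a \<in> carrier A; a' \<in> carrier A; b \<in> carrier B\<rbrakk> \<Longrightarrow>
    Poly_Mapping.single (a \<oplus>\<^bsub>A\<^esub> a', b) 1 - Poly_Mapping.single (a, b) 1 - Poly_Mapping.single (a', b) 1 \<in> N"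
  "\<lbrakk>a \<in> carrier A; b \<in> carrier B; b' \<in> carrier B\<rbrakk> \<Longrightarrow>
    Poly_Mapping.single (a, b \<oplus>\<^bsub>B\<^esub> b') 1 - Poly_Mapping.single (a, b) 1 - Poly_Mapping.single (a, b') 1 \<in> N"
  "\<lbrakk>a \<in> carrier A; b \<in> carrier B\<rbrakk> \<Longrightarrow>
    Poly_Mapping.single (c \<odot>\<^bsub>A\<^esub> a, b) 1 - Poly_Mapping.single (a, b) c \<in> N"
  "\<lbrakk>a \<in> carrier A; b \<in> carrier B\<rbrakk> \<Longrightarrow>
    Poly_Mapping.single (a, c \<odot>\<^bsub>B\<^esub> b) 1 - Poly_Mapping.single (a, b) c \<in> N"
  by (rule subsetD[OF relators_null], unfold tensor_relators_def, blast)+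

text \<open>Multiplying a bilinearity relator by a pair \<open>(a, b)\<close> gives another bilinearity relator.\<close>

lemma null_absorbs_pair:
  assumes "p \<in> carrier (A \<times>\<times> B)" "x \<in> N"
  shows "Poly_Mapping.single p 1 \<otimes>\<^bsub>F\<^esub> x \<in> N" "x \<otimes>\<^bsub>F\<^esub> Poly_Mapping.single p 1 \<in> N"
proof -
  obtain a b where p: "p = (a, b)" and ab: "a \<in> carrier A" "b \<in> carrier B" using assms(1) by auto
  let ?s = "Poly_Mapping.single p (1::complex)"
  have s: "?s \<in> carrier F" using assms(1) by auto
  note lin = F.left_mult_linear[OF s] F.right_mult_linear[OF s]
  note pre = F.submodule_preimage[OF F.complex_algebra_axioms _ submodule_null]
  have "?s \<otimes>\<^bsub>F\<^esub> r \<in> N \<and> r \<otimes>\<^bsub>F\<^esub> ?s \<in> N" if "r \<in> tensor_relators A B" for r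
    using that
    by (induction r rule: relators_induct)
      (simp_all add: p ab monoid_algebra_mult_diff A.r_distr B.r_distr A.smult_mult_right B.smult_mult_right
        A.l_distr B.l_distr A.smult_mult_left B.smult_mult_left relators_null')
  then have rel: "tensor_relators A B \<subseteq> {x \<in> carrier F. ?s \<otimes>\<^bsub>F\<^esub> x \<in> N}"
    and rel': "tensor_relators A B \<subseteq> {x \<in> carrier F. x \<otimes>\<^bsub>F\<^esub> ?s \<in> N}"
    using relators_subset by blast+
  from null_least[OF pre[OF lin(1)] rel] null_least[OF pre[OF lin(2)] rel']
  show "?s \<otimes>\<^bsub>F\<^esub> x \<in> N" "x \<otimes>\<^bsub>F\<^esub> ?s \<in> N" using assms(2) by blast+
qed

text \<open>Every element of the monoid algebra is a linear combination of pairs, so absorption of pairs gives an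
  ideal. Hence the tensor product, defined as a quotient by a subspace, is an algebra.\<close>

lemma null_ideal: "ideal N F"
proof (rule idealI)
  show "ring F" by unfold_locales
  show "subgroup N (add_monoid F)" using submodule_null by (simp add: submodule_def)
  note sub = F.submoduleE[OF submodule_null]
  fix x f assume x: "x \<in> N" and "f \<in> carrier F"
  then have xF: "x \<in> carrier F" using sub(1) by blast
  have sF: "(\<lambda>p. Poly_Mapping.single p 1) ` carrier (A \<times>\<times> B) \<subseteq> carrier F" by auto
  from \<open>f \<in> carrier F\<close> have "f \<in> lin_span F ((\<lambda>p. Poly_Mapping.single p 1) ` carrier (A \<times>\<times> B))"
    using monoid_algebra_span[OF monoid_pairs] by blast
  then have "f \<in> carrier F \<and> f \<otimes>\<^bsub>F\<^esub> x \<in> N \<and> x \<otimes>\<^bsub>F\<^esub> f \<in> N"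
  proof induction
    case (span_base f)
    then show ?case using null_absorbs_pair[OF _ x] sF by blast
  next
    case (span_add f g)
    then show ?case
      using sub(5) xF F.l_distr[of f g x] F.r_distr[of f g x] F.a_closed[of f g] by simp
  next
    case (span_smult f c)
    then show ?case
      using sub(4) xF F.smult_mult_left[of f x c] F.smult_mult_right[of x f c] F.smult_in[of f c] by simp
  qed
  then show "f \<otimes>\<^bsub>F\<^esub> x \<in> N" "x \<otimes>\<^bsub>F\<^esub> f \<in> N" by auto
qed

sublocale N: algebra_ideal F N
  unfolding algebra_ideal_def using null_ideal F.complex_algebra_axioms by blast

sublocale T: complex_algebra T
  unfolding tensor_algebra_def by (rule N.complex_algebra_quot)

end

lemma linear_maps_minus:
  assumes "complex_algebra A" "complex_algebra B" and f: "f \<in> linear_maps A B"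
    and "x \<in> carrier A" "y \<in> carrier A"
  shows "f (x \<ominus>\<^bsub>A\<^esub> y) = f x \<ominus>\<^bsub>B\<^esub> f y"
proof -
  interpret A: complex_algebra A by fact
  interpret B: complex_algebra B by fact
  show ?thesis
    using assms(4,5) linear_mapsD[OF f]
    by (simp add: a_minus_def A.smult_minus1[symmetric] B.smult_minus1[symmetric])
qed

lemma (in complex_algebra) minus_self [simp]: "x \<in> carrier A \<Longrightarrow> x \<ominus> x = \<zero>"
  by (simp add: a_minus_def M.r_neg)

lemma (in complex_algebra) add_minus_minus:
  "\<lbrakk>x \<in> carrier A; y \<in> carrier A\<rbrakk> \<Longrightarrow> (x \<oplus> y) \<ominus> x \<ominus> y = \<zero>"
proof -
  assume xy: "x \<in> carrier A" "y \<in> carrier A"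
  then have "(x \<oplus> y) \<ominus> x = y" by (metis a_minus_def M.a_assoc M.a_comm M.a_inv_closed M.r_neg2)
  then show ?thesis using xy by simp
qed

lemma linear_maps_sum:
  assumes "complex_algebra B" "f \<in> linear_maps A B" "g \<in> linear_maps A B"
  shows "(\<lambda>x. f x \<oplus>\<^bsub>B\<^esub> g x) \<in> linear_maps A B"
proof -
  interpret B: complex_algebra B by fact
  show ?thesis
    by (rule linear_mapsI)
      (simp_all add: linear_mapsD[OF assms(2)] linear_mapsD[OF assms(3)] B.smult_add_right B.M.a_ac)
qed

lemma linear_maps_scale:
  assumes "complex_algebra B" "f \<in> linear_maps A B"
  shows "(\<lambda>x. c \<odot>\<^bsub>B\<^esub> f x) \<in> linear_maps A B"
proof -
  interpret B: complex_algebra B by fact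
  show ?thesis
    by (rule linear_mapsI)
      (simp_all add: linear_mapsD[OF assms(2)] B.smult_add_right B.smult_smult mult.commute)
qed

context tensor_product
begin

lemmas coset_hom = N.coset_alg_hom[folded tensor_algebra_def]

lemma single_in: "\<lbrakk>a \<in> carrier A; b \<in> carrier B\<rbrakk> \<Longrightarrow> Poly_Mapping.single (a, b) c \<in> carrier F"
  by simp

lemma pure_closed [simp, intro]: "\<lbrakk>a \<in> carrier A; b \<in> carrier B\<rbrakk> \<Longrightarrow> pure a b \<in> carrier T"
  unfolding pure_tensor_def using linear_mapsD(1)[OF alg_homsD(1)[OF coset_hom] single_in] .

lemma pure_one: "\<one>\<^bsub>T\<^esub> = pure \<one>\<^bsub>A\<^esub> \<one>\<^bsub>B\<^esub>"
  using alg_homsD(2)[OF coset_hom] by (simp add: pure_tensor_def)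

lemma pure_mult:
  "\<lbrakk>a \<in> carrier A; b \<in> carrier B; a' \<in> carrier A; b' \<in> carrier B\<rbrakk> \<Longrightarrow>
    pure a b \<otimes>\<^bsub>T\<^esub> pure a' b' = pure (a \<otimes>\<^bsub>A\<^esub> a') (b \<otimes>\<^bsub>B\<^esub> b')"
  unfolding pure_tensor_def
  using alg_homsD(3)[OF coset_hom single_in single_in, of a b a' b' 1 1] by simp

lemma coset_single: "\<lbrakk>a \<in> carrier A; b \<in> carrier B\<rbrakk> \<Longrightarrow>
    N +>\<^bsub>F\<^esub> Poly_Mapping.single (a, b) c = c \<odot>\<^bsub>T\<^esub> pure a b"
  unfolding pure_tensor_def
  using linear_mapsD(3)[OF alg_homsD(1)[OF coset_hom] single_in, of a b c 1] by simp

lemma coset_add: "\<lbrakk>x \<in> carrier F; y \<in> carrier F\<rbrakk> \<Longrightarrow>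
    N +>\<^bsub>F\<^esub> (x + y) = (N +>\<^bsub>F\<^esub> x) \<oplus>\<^bsub>T\<^esub> (N +>\<^bsub>F\<^esub> y)"
  using linear_mapsD(2)[OF alg_homsD(1)[OF coset_hom], of x y] by simp

lemma coset_eq: "\<lbrakk>x \<in> carrier F; y \<in> carrier F; x - y \<in> N\<rbrakk> \<Longrightarrow> N +>\<^bsub>F\<^esub> x = N +>\<^bsub>F\<^esub> y"
  by (rule N.coset_eqI) (simp_all add: monoid_algebra_minus[OF monoid_pairs])

lemma pure_add_left:
  assumes "a \<in> carrier A" "a' \<in> carrier A" "b \<in> carrier B"
  shows "pure (a \<oplus>\<^bsub>A\<^esub> a') b = pure a b \<oplus>\<^bsub>T\<^esub> pure a' b"
proof -
  have "N +>\<^bsub>F\<^esub> Poly_Mapping.single (a \<oplus>\<^bsub>A\<^esub> a', b) 1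
      = N +>\<^bsub>F\<^esub> (Poly_Mapping.single (a, b) 1 + Poly_Mapping.single (a', b) 1)"
    by (rule coset_eq) (use assms relators_null'(1)[OF assms] F.a_closed[OF single_in single_in, of a b a' b 1 1]
        in \<open>simp_all add: diff_diff_add\<close>)
  then show ?thesis using assms by (simp add: pure_tensor_def coset_add)
qed

lemma pure_add_right:
  assumes "a \<in> carrier A" "b \<in> carrier B" "b' \<in> carrier B"
  shows "pure a (b \<oplus>\<^bsub>B\<^esub> b') = pure a b \<oplus>\<^bsub>T\<^esub> pure a b'"
proof -
  have "N +>\<^bsub>F\<^esub> Poly_Mapping.single (a, b \<oplus>\<^bsub>B\<^esub> b') 1
      = N +>\<^bsub>F\<^esub> (Poly_Mapping.single (a, b) 1 + Poly_Mapping.single (a, b') 1)"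
    by (rule coset_eq) (use assms relators_null'(2)[OF assms] F.a_closed[OF single_in single_in, of a b a b' 1 1]
        in \<open>simp_all add: diff_diff_add\<close>)
  then show ?thesis using assms by (simp add: pure_tensor_def coset_add)
qed

lemma pure_smult_left:
  assumes "a \<in> carrier A" "b \<in> carrier B"
  shows "pure (c \<odot>\<^bsub>A\<^esub> a) b = c \<odot>\<^bsub>T\<^esub> pure a b"
proof -
  have "N +>\<^bsub>F\<^esub> Poly_Mapping.single (c \<odot>\<^bsub>A\<^esub> a, b) 1 = N +>\<^bsub>F\<^esub> Poly_Mapping.single (a, b) c"
    by (rule coset_eq) (use assms relators_null'(3)[OF assms] in simp_all)
  then show ?thesis using assms by (simp add: coset_single flip: pure_tensor_def)
qed

lemma pure_smult_right:
  assumes "a \<in> carrier A" "b \<in> carrier B"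
  shows "pure a (c \<odot>\<^bsub>B\<^esub> b) = c \<odot>\<^bsub>T\<^esub> pure a b"
proof -
  have "N +>\<^bsub>F\<^esub> Poly_Mapping.single (a, c \<odot>\<^bsub>B\<^esub> b) 1 = N +>\<^bsub>F\<^esub> Poly_Mapping.single (a, b) c"
    by (rule coset_eq) (use assms relators_null'(4)[OF assms] in simp_all)
  then show ?thesis using assms by (simp add: coset_single flip: pure_tensor_def)
qed

abbreviation pures where "pures \<equiv> (\<lambda>(a, b). pure a b) ` (carrier A \<times> carrier B)"

lemma pures_subset: "pures \<subseteq> carrier T"
  by auto

text \<open>The coset of a monomial \<open>c (a, b)\<close> is \<open>c\<close> times a pure tensor, and monomials span.\<close>

lemma pures_span: "lin_span T pures = carrier T"
proof
  show "lin_span T pures \<subseteq> carrier T" by (rule T.lin_span_subset[OF pures_subset])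
  show "carrier T \<subseteq> lin_span T pures"
  proof
    fix t assume "t \<in> carrier T"
    then obtain f where f: "f \<in> carrier F" and t: "t = N +>\<^bsub>F\<^esub> f"
      by (auto simp: tensor_algebra_def quot_algebra_simps)
    have "Poly_Mapping.keys f \<subseteq> carrier A \<times> carrier B" using f by simp
    moreover have "carrier A \<times> carrier B \<noteq> {}" using A.one_closed B.one_closed by blast
    ultimately have "N +>\<^bsub>F\<^esub> f \<in> lin_span T pures"
    proof (induction f rule: free_induct)
      case (single p c)
      then obtain a b where p: "p = (a, b)" "a \<in> carrier A" "b \<in> carrier B" by blast
      then have "pure a b \<in> lin_span T pures" by (intro lin_span.span_base) auto
      then show ?case using p by (simp add: coset_single lin_span.span_smult)
    next
      case (add f g)
      then show ?case by (simp add: coset_add lin_span.span_add)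
    qed
    then show "t \<in> lin_span T pures" using t by simp
  qed
qed

lemma linear_eq_on_pures:
  assumes "f \<in> linear_maps T V" "g \<in> linear_maps T V"
    and "\<And>a b. \<lbrakk>a \<in> carrier A; b \<in> carrier B\<rbrakk> \<Longrightarrow> f (pure a b) = g (pure a b)" and "t \<in> carrier T"
  shows "f t = g t"
  by (rule linear_maps_eq_on_span[OF T.complex_algebra_axioms pures_subset pures_span assms(1,2) _ assms(4)])
     (use assms(3) in auto)

lemma pure_bilinear: "(\<lambda>(a, b). pure a b) \<in> bilinear_maps A B T"
  by (rule bilinear_mapsI; rule linear_mapsI)
     (simp_all add: pure_add_left pure_add_right pure_smult_left pure_smult_right)

text \<open>The linear extension of a bilinear map kills each relator, hence the whole null space.\<close>

lemma lin_ext_null: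
  assumes V: "complex_algebra V" and \<phi>: "\<phi> \<in> bilinear_maps A B V" and "x \<in> N"
  shows "lin_ext V \<phi> x = \<zero>\<^bsub>V\<^esub>"
proof -
  interpret V: complex_algebra V by fact
  note \<phi>D = linear_mapsD[OF bilinear_mapsD(1)[OF \<phi>]] linear_mapsD[OF bilinear_mapsD(2)[OF \<phi>]]
  have \<phi>V: "\<phi> \<in> carrier (A \<times>\<times> B) \<rightarrow> carrier V" using \<phi>D(1) by auto
  have lin: "lin_ext V \<phi> \<in> linear_maps F V" by (rule lin_ext_linear[OF V.vector_space \<phi>V])
  have single: "lin_ext V \<phi> (Poly_Mapping.single (a, b) c) = c \<odot>\<^bsub>V\<^esub> \<phi> (a, b)"
    if "a \<in> carrier A" "b \<in> carrier B" for a b c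
    by (rule lin_ext_single[OF V.vector_space]) (use that \<phi>D(1) in auto)
  have diff: "lin_ext V \<phi> (f - g) = lin_ext V \<phi> f \<ominus>\<^bsub>V\<^esub> lin_ext V \<phi> g"
    if "Poly_Mapping.keys f \<subseteq> carrier A \<times> carrier B" "Poly_Mapping.keys g \<subseteq> carrier A \<times> carrier B" for f g
    using linear_maps_minus[OF F.complex_algebra_axioms V lin, of f g] that
    by (simp add: monoid_algebra_minus[OF monoid_pairs])
  have "lin_ext V \<phi> r = \<zero>\<^bsub>V\<^esub>" if "r \<in> tensor_relators A B" for r
    using that
    by (induction r rule: relators_induct)
      (simp_all add: diff single keys_diff_in \<phi>D V.add_minus_minus)
  then have "tensor_relators A B \<subseteq> {x \<in> carrier F. lin_ext V \<phi> x \<in> {\<zero>\<^bsub>V\<^esub>}}"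
    using relators_subset by auto
  from null_least[OF F.submodule_preimage[OF V lin V.submodule_zero] this] assms(3)
  show ?thesis by blast
qed

lemma
  assumes V: "complex_algebra V" and \<phi>: "\<phi> \<in> bilinear_maps A B V"
  shows tensor_lift_linear: "tensor_lift V \<phi> \<in> linear_maps T V"
    and tensor_lift_pure: "\<lbrakk>a \<in> carrier A; b \<in> carrier B\<rbrakk> \<Longrightarrow> tensor_lift V \<phi> (pure a b) = \<phi> (a, b)"
proof -
  interpret V: complex_algebra V by fact
  have \<phi>V: "\<phi> \<in> carrier (A \<times>\<times> B) \<rightarrow> carrier V"
    using linear_mapsD(1)[OF bilinear_mapsD(1)[OF \<phi>]] by auto
  have lift: "tensor_lift V \<phi> = (\<lambda>X. the_elem (lin_ext V \<phi> ` X))"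
    by (simp add: tensor_lift_def lin_ext_def fun_eq_iff)
  have lin: "lin_ext V \<phi> \<in> linear_maps F V" by (rule lin_ext_linear[OF V.vector_space \<phi>V])
  note null = lin_ext_null[OF V \<phi>]
  show "tensor_lift V \<phi> \<in> linear_maps T V"
    unfolding lift tensor_algebra_def by (rule N.quot_lift_linear[OF V lin null])
  assume ab: "a \<in> carrier A" "b \<in> carrier B"
  have "tensor_lift V \<phi> (pure a b) = lin_ext V \<phi> (Poly_Mapping.single (a, b) 1)"
    unfolding lift pure_tensor_def by (rule N.quot_lift_coset[OF V lin null single_in[OF ab]])
  also have "\<dots> = 1 \<odot>\<^bsub>V\<^esub> \<phi> (a, b)"
    by (rule lin_ext_single[OF V.vector_space]) (use \<phi>V ab in auto)
  also have "\<dots> = \<phi> (a, b)" by (rule V.smult_1) (use \<phi>V ab in auto)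
  finally show "tensor_lift V \<phi> (pure a b) = \<phi> (a, b)" .
qed

end

lemma bilinear_maps_comp:
  assumes "\<phi> \<in> bilinear_maps A B V" "f \<in> linear_maps C A" "g \<in> linear_maps D B"
  shows "(\<lambda>(c, d). \<phi> (f c, g d)) \<in> bilinear_maps C D V"
proof (rule bilinear_mapsI)
  fix c assume "c \<in> carrier C"
  then show "(\<lambda>d. case (c, d) of (c, d) \<Rightarrow> \<phi> (f c, g d)) \<in> linear_maps D V"
    using linear_maps_comp[OF assms(3) bilinear_mapsD(1)[OF assms(1)], of "f c"] linear_mapsD(1)[OF assms(2)]
    by simp
next
  fix d assume "d \<in> carrier D"
  then show "(\<lambda>c. case (c, d) of (c, d) \<Rightarrow> \<phi> (f c, g d)) \<in> linear_maps C V"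
    using linear_maps_comp[OF assms(2) bilinear_mapsD(2)[OF assms(1)], of "g d"] linear_mapsD(1)[OF assms(3)]
    by simp
qed

lemma
  assumes "tensor_product A B" "tensor_product C D" "f \<in> linear_maps C A" "g \<in> linear_maps D B"
  shows tensor_map_linear: "tensor_map A B f g \<in> linear_maps (C \<otimes>\<^sub>A D) (A \<otimes>\<^sub>A B)"
    and tensor_map_pure: "\<lbrakk>c \<in> carrier C; d \<in> carrier D\<rbrakk> \<Longrightarrow>
      tensor_map A B f g (pure_tensor C D c d) = pure_tensor A B (f c) (g d)"
proof -
  interpret AB: tensor_product A B by fact
  interpret CD: tensor_product C D by fact
  have "(\<lambda>(c, d). pure_tensor A B (f c) (g d)) \<in> bilinear_maps C D (A \<otimes>\<^sub>A B)"
    using bilinear_maps_comp[OF AB.pure_bilinear assms(3,4)] by simp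
  note lift = CD.tensor_lift_linear[OF AB.T.complex_algebra_axioms this]
    CD.tensor_lift_pure[OF AB.T.complex_algebra_axioms this]
  show "tensor_map A B f g \<in> linear_maps (C \<otimes>\<^sub>A D) (A \<otimes>\<^sub>A B)"
    unfolding tensor_map_def by (rule lift(1))
  show "tensor_map A B f g (pure_tensor C D c d) = pure_tensor A B (f c) (g d)"
    if "c \<in> carrier C" "d \<in> carrier D"
    unfolding tensor_map_def using lift(2)[OF that] by simp
qed

lemma tensor_map_alg_hom:
  assumes "tensor_product A B" "tensor_product C D" "f \<in> alg_homs C A" "g \<in> alg_homs D B"
  shows "tensor_map A B f g \<in> alg_homs (C \<otimes>\<^sub>A D) (A \<otimes>\<^sub>A B)"
proof -
  interpret AB: tensor_product A B by fact
  interpret CD: tensor_product C D by fact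
  note f = alg_homsD[OF assms(3)] and g = alg_homsD[OF assms(4)]
  note map = tensor_map_linear[OF assms(1,2) f(1) g(1)] tensor_map_pure[OF assms(1,2) f(1) g(1)]
  note closed = linear_mapsD(1)[OF f(1)] linear_mapsD(1)[OF g(1)]
  show ?thesis
  proof (rule alg_homs_on_span[OF CD.T.complex_algebra_axioms AB.T.complex_algebra_axioms
        CD.pures_subset CD.pures_span map(1)])
    show "tensor_map A B f g \<one>\<^bsub>C \<otimes>\<^sub>A D\<^esub> = \<one>\<^bsub>A \<otimes>\<^sub>A B\<^esub>"
      by (simp add: CD.pure_one AB.pure_one map(2) f(2) g(2))
    fix s t assume "s \<in> CD.pures" "t \<in> CD.pures"
    then show "tensor_map A B f g (s \<otimes>\<^bsub>C \<otimes>\<^sub>A D\<^esub> t)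
        = tensor_map A B f g s \<otimes>\<^bsub>A \<otimes>\<^sub>A B\<^esub> tensor_map A B f g t"
      by (clarsimp simp: CD.pure_mult map(2) AB.pure_mult f(3) g(3) closed)
  qed
qed

locale triple_tensor = A: complex_algebra A + B: complex_algebra B + C: complex_algebra C
  for A :: "(complex, 'a, 'm) module_scheme" and B :: "(complex, 'b, 'n) module_scheme"
    and C :: "(complex, 'c, 'k) module_scheme"
begin

sublocale AB: tensor_product A B by unfold_locales
sublocale BC: tensor_product B C by unfold_locales
sublocale AB_C: tensor_product "A \<otimes>\<^sub>A B" C by unfold_locales
sublocale A_BC: tensor_product A "B \<otimes>\<^sub>A C" by unfold_locales

text \<open>On these triple tensors the associator is given by a formula, so that its multiplicativity can be read
  off without expanding elements of \<open>A \<otimes> B\<close>.\<close>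

lemma triples_span:
  "lin_span AB_C.T {AB_C.pure (AB.pure a b) c | a b c. a \<in> carrier A \<and> b \<in> carrier B \<and> c \<in> carrier C}
    = carrier AB_C.T" (is "lin_span _ ?X = _")
proof
  show "lin_span AB_C.T ?X \<subseteq> carrier AB_C.T" by (rule AB_C.T.lin_span_subset) auto
  have pure: "AB_C.pure t c \<in> lin_span AB_C.T ?X" if "t \<in> carrier AB.T" and c: "c \<in> carrier C" for t c
  proof -
    from that(1) have "t \<in> lin_span AB.T AB.pures" by (simp add: AB.pures_span)
    then have "t \<in> carrier AB.T \<and> AB_C.pure t c \<in> lin_span AB_C.T ?X"
    proof induction
      case (span_base t)
      then show ?case using c by (auto intro!: lin_span.span_base)
    next
      case (span_add s t)
      then show ?case using c by (simp add: AB_C.pure_add_left lin_span.span_add)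
    next
      case (span_smult t k)
      then show ?case using c by (simp add: AB_C.pure_smult_left lin_span.span_smult)
    qed
    then show ?thesis ..
  qed
  show "carrier AB_C.T \<subseteq> lin_span AB_C.T ?X"
  proof
    fix u assume "u \<in> carrier AB_C.T"
    then have "u \<in> lin_span AB_C.T AB_C.pures" by (simp add: AB_C.pures_span)
    then show "u \<in> lin_span AB_C.T ?X"
      by induction (auto intro: lin_span.intros pure)
  qed
qed

lemma
  shows tensor_assoc_pure: "\<lbrakk>a \<in> carrier A; b \<in> carrier B; c \<in> carrier C\<rbrakk> \<Longrightarrow>
      tensor_assoc A B C (AB_C.pure (AB.pure a b) c) = A_BC.pure a (BC.pure b c)"
    and tensor_assoc_alg_hom: "tensor_assoc A B C \<in> alg_homs AB_C.T A_BC.T"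
proof -
  note V = A_BC.T.complex_algebra_axioms
  let ?\<psi> = "\<lambda>c. tensor_lift A_BC.T (\<lambda>(a, b). A_BC.pure a (BC.pure b c))"
  have "(\<lambda>(a, b). A_BC.pure a (BC.pure b c)) \<in> bilinear_maps A B A_BC.T" if "c \<in> carrier C" for c
    by (rule bilinear_mapsI; rule linear_mapsI)
      (simp_all add: that BC.pure_add_left BC.pure_smult_left A_BC.pure_add_left A_BC.pure_add_right
        A_BC.pure_smult_left A_BC.pure_smult_right)
  note \<psi>_linear = AB.tensor_lift_linear[OF V this] and \<psi>_pure' = AB.tensor_lift_pure[OF V this]
  have \<psi>_pure: "?\<psi> c (AB.pure a b) = A_BC.pure a (BC.pure b c)"
    if "a \<in> carrier A" "b \<in> carrier B" "c \<in> carrier C" for a b c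
    using \<psi>_pure'[OF that(3,1,2)] by simp
  \<comment> \<open>Linearity in \<open>c\<close> for an arbitrary tensor \<open>t\<close> is an identity between linear functions of \<open>t\<close>.\<close>
  have "(\<lambda>(t, c). ?\<psi> c t) \<in> bilinear_maps AB.T C A_BC.T"
  proof (rule bilinear_mapsI)
    fix t assume t: "t \<in> carrier AB.T"
    show "(\<lambda>c. case (t, c) of (t, c) \<Rightarrow> ?\<psi> c t) \<in> linear_maps C A_BC.T"
    proof (rule linear_mapsI; simp)
      fix c assume c: "c \<in> carrier C"
      show "?\<psi> c t \<in> carrier A_BC.T" by (rule linear_mapsD(1)[OF \<psi>_linear[OF c] t])
      show "?\<psi> (k \<odot>\<^bsub>C\<^esub> c) t = k \<odot>\<^bsub>A_BC.T\<^esub> ?\<psi> c t" for k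
        by (rule AB.linear_eq_on_pures[OF \<psi>_linear linear_maps_scale[OF V \<psi>_linear[OF c]] _ t])
          (use c in \<open>simp_all add: \<psi>_pure BC.pure_smult_right A_BC.pure_smult_right\<close>)
      fix c' assume c': "c' \<in> carrier C"
      show "?\<psi> (c \<oplus>\<^bsub>C\<^esub> c') t = ?\<psi> c t \<oplus>\<^bsub>A_BC.T\<^esub> ?\<psi> c' t"
        by (rule AB.linear_eq_on_pures[OF \<psi>_linear
              linear_maps_sum[OF V \<psi>_linear[OF c] \<psi>_linear[OF c']] _ t])
          (use c c' in \<open>simp_all add: \<psi>_pure BC.pure_add_right A_BC.pure_add_right\<close>)
    qed
  qed (simp add: \<psi>_linear)
  note lift = AB_C.tensor_lift_linear[OF V this] AB_C.tensor_lift_pure[OF V this]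
  have assoc_linear: "tensor_assoc A B C \<in> linear_maps AB_C.T A_BC.T"
    unfolding tensor_assoc_def by (rule lift(1))
  show assoc_pure: "tensor_assoc A B C (AB_C.pure (AB.pure a b) c) = A_BC.pure a (BC.pure b c)"
    if "a \<in> carrier A" "b \<in> carrier B" "c \<in> carrier C" for a b c
    unfolding tensor_assoc_def using lift(2)[OF AB.pure_closed[OF that(1,2)] that(3)]
    by (simp add: \<psi>_pure that)
  show "tensor_assoc A B C \<in> alg_homs AB_C.T A_BC.T"
  proof (rule alg_homs_on_span[OF AB_C.T.complex_algebra_axioms V _ triples_span assoc_linear])
    show "tensor_assoc A B C \<one>\<^bsub>AB_C.T\<^esub> = \<one>\<^bsub>A_BC.T\<^esub>"
      by (simp add: AB_C.pure_one AB.pure_one A_BC.pure_one BC.pure_one assoc_pure)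
    let ?X = "{AB_C.pure (AB.pure a b) c | a b c. a \<in> carrier A \<and> b \<in> carrier B \<and> c \<in> carrier C}"
    show "?X \<subseteq> carrier AB_C.T" by auto
    fix s t assume "s \<in> ?X" "t \<in> ?X"
    then obtain a b c a' b' c' where st: "s = AB_C.pure (AB.pure a b) c" "t = AB_C.pure (AB.pure a' b') c'"
      and "a \<in> carrier A" "b \<in> carrier B" "c \<in> carrier C" "a' \<in> carrier A" "b' \<in> carrier B" "c' \<in> carrier C"
      by blast
    then show "tensor_assoc A B C (s \<otimes>\<^bsub>AB_C.T\<^esub> t)
        = tensor_assoc A B C s \<otimes>\<^bsub>A_BC.T\<^esub> tensor_assoc A B C t"
      by (simp add: st assoc_pure AB_C.pure_mult AB.pure_mult A_BC.pure_mult BC.pure_mult)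
  qed
qed

end

section \<open>Hopf axioms on generators\<close>

inductive_set subalgebra_generated for A (structure) and X where
  gen_one: "\<one> \<in> subalgebra_generated A X"
| gen_base: "x \<in> X \<Longrightarrow> x \<in> subalgebra_generated A X"
| gen_add: "\<lbrakk>x \<in> subalgebra_generated A X; y \<in> subalgebra_generated A X\<rbrakk> \<Longrightarrow>
    x \<oplus> y \<in> subalgebra_generated A X"
| gen_mult: "\<lbrakk>x \<in> subalgebra_generated A X; y \<in> subalgebra_generated A X\<rbrakk> \<Longrightarrow>
    x \<otimes> y \<in> subalgebra_generated A X"
| gen_smult: "x \<in> subalgebra_generated A X \<Longrightarrow> c \<odot> x \<in> subalgebra_generated A X"

lemma (in complex_algebra) generated_induct [consumes 3, case_names one base add mult smult]:
  assumes "x \<in> carrier A" and X: "X \<subseteq> carrier A" "subalgebra_generated A X = carrier A"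
    and "P \<one>" and "\<And>x. x \<in> X \<Longrightarrow> P x"
    and "\<And>x y. \<lbrakk>x \<in> carrier A; y \<in> carrier A; P x; P y\<rbrakk> \<Longrightarrow> P (x \<oplus> y)"
    and "\<And>x y. \<lbrakk>x \<in> carrier A; y \<in> carrier A; P x; P y\<rbrakk> \<Longrightarrow> P (x \<otimes> y)"
    and "\<And>c x. \<lbrakk>x \<in> carrier A; P x\<rbrakk> \<Longrightarrow> P (c \<odot> x)"
  shows "P x"
proof -
  from assms(1) have "x \<in> subalgebra_generated A X" by (simp only: X)
  then show ?thesis by induction (simp_all add: assms(4-8) X)
qed

lemma alg_homs_eq_on_generators:
  assumes "complex_algebra A" and X: "X \<subseteq> carrier A" "subalgebra_generated A X = carrier A"
    and f: "f \<in> alg_homs A B" and g: "g \<in> alg_homs A B"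
    and eq: "\<And>x. x \<in> X \<Longrightarrow> f x = g x" and x: "x \<in> carrier A"
  shows "f x = g x"
proof -
  interpret A: complex_algebra A by fact
  note fD = linear_mapsD[OF alg_homsD(1)[OF f]] alg_homsD(2,3)[OF f]
  note gD = linear_mapsD[OF alg_homsD(1)[OF g]] alg_homsD(2,3)[OF g]
  from x X show ?thesis
    by (induction rule: A.generated_induct) (simp_all add: eq fD gD)
qed

text \<open>The axioms of a Hopf algebra that quantify over elements, at a single element \<open>x\<close>.\<close>

definition hopf_axioms_at where
  "hopf_axioms_at H \<Delta> \<epsilon> S x \<longleftrightarrow>
    tensor_assoc H H H (tensor_map (H \<otimes>\<^sub>A H) H \<Delta> id (\<Delta> x)) = tensor_map H (H \<otimes>\<^sub>A H) id \<Delta> (\<Delta> x) \<and>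
    tensor_map complexes H \<epsilon> id (\<Delta> x) = pure_tensor complexes H 1 x \<and>
    tensor_map H complexes id \<epsilon> (\<Delta> x) = pure_tensor H complexes x 1 \<and>
    mult_map H (tensor_map H H S id (\<Delta> x)) = \<epsilon> x \<odot>\<^bsub>H\<^esub> \<one>\<^bsub>H\<^esub> \<and>
    mult_map H (tensor_map H H id S (\<Delta> x)) = \<epsilon> x \<odot>\<^bsub>H\<^esub> \<one>\<^bsub>H\<^esub>"

locale hopf_data = H: complex_algebra H for H (structure) +
  fixes \<Delta> :: "'a \<Rightarrow> ('a \<times> 'a \<Rightarrow>\<^sub>0 complex) set" and \<epsilon> :: "'a \<Rightarrow> complex" and S :: "'a \<Rightarrow> 'a"
  assumes comult: "\<Delta> \<in> alg_homs H (H \<otimes>\<^sub>A H)"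
    and counit: "\<epsilon> \<in> alg_homs H complexes"
    and antipode: "S \<in> alg_antihoms H H"
begin

sublocale C: complex_algebra complexes by (rule complex_algebra_complexes)
sublocale HH: tensor_product H H by unfold_locales
sublocale HHH: triple_tensor H H H by unfold_locales
sublocale CH: tensor_product complexes H by unfold_locales
sublocale HC: tensor_product H complexes by unfold_locales

lemma antipode_linear: "S \<in> linear_maps H H"
  and antipode_one: "S \<one> = \<one>"
  and antipode_mult: "\<lbrakk>x \<in> carrier H; y \<in> carrier H\<rbrakk> \<Longrightarrow> S (x \<otimes> y) = S y \<otimes> S x"
  using antipode by (auto simp: alg_antihoms_def)

lemmas S_simps = antipode_one antipode_mult linear_mapsD[OF antipode_linear]
lemmas comult_simps = alg_homsD(2,3)[OF comult] linear_mapsD[OF alg_homsD(1)[OF comult]]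
lemmas counit_simps = alg_homsD(2,3)[OF counit] linear_mapsD(2,3)[OF alg_homsD(1)[OF counit]]

lemma
  shows mult_map_linear: "mult_map H \<in> linear_maps HH.T H"
    and mult_map_pure: "\<lbrakk>a \<in> carrier H; b \<in> carrier H\<rbrakk> \<Longrightarrow> mult_map H (HH.pure a b) = a \<otimes> b"
proof -
  have "(\<lambda>(a, b). a \<otimes> b) \<in> bilinear_maps H H H"
    by (rule bilinear_mapsI) (simp_all add: H.left_mult_linear H.right_mult_linear)
  note lift = HH.tensor_lift_linear[OF H.complex_algebra_axioms this]
    HH.tensor_lift_pure[OF H.complex_algebra_axioms this]
  show "mult_map H \<in> linear_maps HH.T H" unfolding mult_map_def by (rule lift(1))
  show "mult_map H (HH.pure a b) = a \<otimes> b" if "a \<in> carrier H" "b \<in> carrier H"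
    unfolding mult_map_def using lift(2)[OF that] by simp
qed

text \<open>
  The convolution products \<open>S * id\<close> and \<open>id * S\<close>, before composition with the coproduct. As maps on
  \<open>H \<otimes> H\<close> they are linear, but in general not multiplicative.
\<close>

definition conv_left where "conv_left t = mult_map H (tensor_map H H S id t)"
definition conv_right where "conv_right t = mult_map H (tensor_map H H id S t)"

lemmas map_S_id = tensor_map_linear[OF HH.tensor_product_axioms HH.tensor_product_axioms antipode_linear linear_maps_id]
  tensor_map_pure[OF HH.tensor_product_axioms HH.tensor_product_axioms antipode_linear linear_maps_id]
lemmas map_id_S = tensor_map_linear[OF HH.tensor_product_axioms HH.tensor_product_axioms linear_maps_id antipode_linear]
  tensor_map_pure[OF HH.tensor_product_axioms HH.tensor_product_axioms linear_maps_id antipode_linear]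

lemma conv_left_linear: "conv_left \<in> linear_maps HH.T H"
  and conv_right_linear: "conv_right \<in> linear_maps HH.T H"
  unfolding conv_left_def conv_right_def
  by (rule linear_maps_comp[OF map_S_id(1) mult_map_linear])
     (rule linear_maps_comp[OF map_id_S(1) mult_map_linear])

lemma conv_left_pure: "\<lbrakk>a \<in> carrier H; b \<in> carrier H\<rbrakk> \<Longrightarrow> conv_left (HH.pure a b) = S a \<otimes> b"
  and conv_right_pure: "\<lbrakk>a \<in> carrier H; b \<in> carrier H\<rbrakk> \<Longrightarrow> conv_right (HH.pure a b) = a \<otimes> S b"
  by (simp_all add: conv_left_def conv_right_def map_S_id(2) map_id_S(2) mult_map_pure S_simps)

text \<open>On pure tensors \<open>t = a\<^sub>1 \<otimes> b\<^sub>1\<close> and \<open>u = a \<otimes> b\<close> the left-hand side is \<open>S a (S a\<^sub>1 b\<^sub>1) b\<close>. By linearity in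
  \<open>t\<close> it is \<open>S a\<close> times the value at \<open>t\<close> times \<open>b\<close>, and a scalar value can be pulled out in front
  of \<open>S a b\<close>.\<close>

lemma conv_left_mult:
  assumes t: "t \<in> carrier HH.T" "conv_left t = c \<odot> \<one>" and u: "u \<in> carrier HH.T"
  shows "conv_left (t \<otimes>\<^bsub>HH.T\<^esub> u) = c \<odot> conv_left u"
proof (rule HH.linear_eq_on_pures[OF linear_maps_comp[OF HH.T.left_mult_linear[OF t(1)] conv_left_linear]
      linear_maps_scale[OF H.complex_algebra_axioms conv_left_linear] _ u])
  fix a b assume ab: "a \<in> carrier H" "b \<in> carrier H"
  have "conv_left (t \<otimes>\<^bsub>HH.T\<^esub> HH.pure a b) = (S a \<otimes> conv_left t) \<otimes> b"
  proof (rule HH.linear_eq_on_pures[OF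
        linear_maps_comp[OF HH.T.right_mult_linear[OF HH.pure_closed[OF ab]] conv_left_linear]
        linear_maps_comp[OF linear_maps_comp[OF conv_left_linear H.left_mult_linear] H.right_mult_linear] _ t(1)])
    fix a' b' assume "a' \<in> carrier H" "b' \<in> carrier H"
    then show "conv_left (HH.pure a' b' \<otimes>\<^bsub>HH.T\<^esub> HH.pure a b) = (S a \<otimes> conv_left (HH.pure a' b')) \<otimes> b"
      using ab by (simp add: HH.pure_mult conv_left_pure S_simps H.m_assoc)
  qed (use ab in \<open>simp_all add: S_simps\<close>)
  then show "conv_left (t \<otimes>\<^bsub>HH.T\<^esub> HH.pure a b) = c \<odot> conv_left (HH.pure a b)"
    using ab by (simp add: t(2) conv_left_pure S_simps H.smult_mult_left H.smult_mult_right)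
qed

text \<open>Here the scalar has to come from the second factor, since \<open>a a\<^sub>1 S(b\<^sub>1) S(b)\<close> has the value at \<open>u = a\<^sub>1 \<otimes> b\<^sub>1\<close>
  in the middle.\<close>

lemma conv_right_mult:
  assumes t: "t \<in> carrier HH.T" and u: "u \<in> carrier HH.T" "conv_right u = c \<odot> \<one>"
  shows "conv_right (t \<otimes>\<^bsub>HH.T\<^esub> u) = c \<odot> conv_right t"
proof (rule HH.linear_eq_on_pures[OF linear_maps_comp[OF HH.T.right_mult_linear[OF u(1)] conv_right_linear]
      linear_maps_scale[OF H.complex_algebra_axioms conv_right_linear] _ t])
  fix a b assume ab: "a \<in> carrier H" "b \<in> carrier H"
  have "conv_right (HH.pure a b \<otimes>\<^bsub>HH.T\<^esub> u) = (a \<otimes> conv_right u) \<otimes> S b"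
  proof (rule HH.linear_eq_on_pures[OF
        linear_maps_comp[OF HH.T.left_mult_linear[OF HH.pure_closed[OF ab]] conv_right_linear]
        linear_maps_comp[OF linear_maps_comp[OF conv_right_linear H.left_mult_linear] H.right_mult_linear] _ u(1)])
    fix a' b' assume "a' \<in> carrier H" "b' \<in> carrier H"
    then show "conv_right (HH.pure a b \<otimes>\<^bsub>HH.T\<^esub> HH.pure a' b') = (a \<otimes> conv_right (HH.pure a' b')) \<otimes> S b"
      using ab by (simp add: HH.pure_mult conv_right_pure S_simps H.m_assoc)
  qed (use ab in \<open>simp_all add: S_simps\<close>)
  then show "conv_right (HH.pure a b \<otimes>\<^bsub>HH.T\<^esub> u) = c \<odot> conv_right (HH.pure a b)"
    using ab by (simp add: u(2) conv_right_pure S_simps H.smult_mult_left H.smult_mult_right)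
qed

text \<open>Coassociativity and the counit axioms are equalities of algebra homomorphisms. The antipode axioms
  follow by induction over the generated subalgebra, with the product step given by the two preceding
  lemmas applied to \<open>\<Delta> x\<close> and \<open>\<Delta> y\<close>.\<close>

lemma hopf_algebra_from_generators:
  assumes X: "X \<subseteq> carrier H" "subalgebra_generated H X = carrier H"
    and at: "\<And>x. x \<in> X \<Longrightarrow> hopf_axioms_at H \<Delta> \<epsilon> S x"
  shows "hopf_algebra H \<Delta> \<epsilon> S"
proof (intro hopf_algebra.intro hopf_algebra_axioms.intro)
  show "complex_algebra H" by unfold_locales
  show "\<Delta> \<in> alg_homs H (H \<otimes>\<^sub>A H)" "\<epsilon> \<in> alg_homs H complexes" "S \<in> linear_maps H H"
    by (rule comult counit antipode_linear)+
  note at' = at[unfolded hopf_axioms_at_def]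
  note eqI = alg_homs_eq_on_generators[OF H.complex_algebra_axioms X]
  fix x assume x: "x \<in> carrier H"
  show "tensor_assoc H H H (tensor_map HH.T H \<Delta> id (\<Delta> x)) = tensor_map H HH.T id \<Delta> (\<Delta> x)"
  proof (rule eqI[OF _ _ _ x])
    show "(\<lambda>x. tensor_assoc H H H (tensor_map HH.T H \<Delta> id (\<Delta> x))) \<in> alg_homs H HHH.A_BC.T"
      by (rule alg_homs_comp[OF alg_homs_comp[OF comult tensor_map_alg_hom[OF HHH.AB_C.tensor_product_axioms
              HH.tensor_product_axioms comult alg_homs_id]] HHH.tensor_assoc_alg_hom])
    show "(\<lambda>x. tensor_map H HH.T id \<Delta> (\<Delta> x)) \<in> alg_homs H HHH.A_BC.T"
      by (intro alg_homs_comp[OF comult]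
          tensor_map_alg_hom[OF HHH.A_BC.tensor_product_axioms HH.tensor_product_axioms alg_homs_id comult])
  qed (use at' in blast)
  show "tensor_map complexes H \<epsilon> id (\<Delta> x) = CH.pure 1 x"
  proof (rule eqI[OF _ _ _ x])
    show "(\<lambda>x. tensor_map complexes H \<epsilon> id (\<Delta> x)) \<in> alg_homs H CH.T"
      by (intro alg_homs_comp[OF comult]
          tensor_map_alg_hom[OF CH.tensor_product_axioms HH.tensor_product_axioms counit alg_homs_id])
    show "CH.pure 1 \<in> alg_homs H CH.T"
      by (intro alg_homsI linear_mapsI)
        (simp_all add: CH.pure_add_right CH.pure_smult_right CH.pure_one CH.pure_mult)
  qed (use at' in blast)
  show "tensor_map H complexes id \<epsilon> (\<Delta> x) = HC.pure x 1"
  proof (rule eqI[OF _ _ _ x])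
    show "(\<lambda>x. tensor_map H complexes id \<epsilon> (\<Delta> x)) \<in> alg_homs H HC.T"
      by (intro alg_homs_comp[OF comult]
          tensor_map_alg_hom[OF HC.tensor_product_axioms HH.tensor_product_axioms alg_homs_id counit])
    show "(\<lambda>x. HC.pure x 1) \<in> alg_homs H HC.T"
      by (intro alg_homsI linear_mapsI)
        (simp_all add: HC.pure_add_left HC.pure_smult_left HC.pure_one HC.pure_mult)
  qed (use at' in blast)
  have conv_at: "conv_left (\<Delta> x) = \<epsilon> x \<odot> \<one>" "conv_right (\<Delta> x) = \<epsilon> x \<odot> \<one>" if "x \<in> X" for x
    using at[OF that] by (simp_all only: hopf_axioms_at_def conv_left_def conv_right_def)
  have "conv_left (\<Delta> x) = \<epsilon> x \<odot> \<one>"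
    using x X
  proof (induction rule: H.generated_induct)
    case one
    then show ?case by (simp add: comult_simps counit_simps HH.pure_one conv_left_pure S_simps)
  next
    case (base x)
    then show ?case by (rule conv_at)
  next
    case (mult x y)
    then show ?case
      using conv_left_mult[of "\<Delta> x" "\<epsilon> x" "\<Delta> y"] by (simp add: comult_simps counit_simps H.smult_smult)
  qed (simp_all add: comult_simps counit_simps linear_mapsD[OF conv_left_linear] H.smult_add_left H.smult_smult)
  then show "mult_map H (tensor_map H H S id (\<Delta> x)) = \<epsilon> x \<odot> \<one>" by (simp only: conv_left_def)
  have "conv_right (\<Delta> x) = \<epsilon> x \<odot> \<one>"
    using x X
  proof (induction rule: H.generated_induct)
    case one
    then show ?case by (simp add: comult_simps counit_simps HH.pure_one conv_right_pure S_simps)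
  next
    case (base x)
    then show ?case by (rule conv_at)
  next
    case (mult x y)
    then show ?case
      using conv_right_mult[of "\<Delta> x" "\<Delta> y" "\<epsilon> y"]
      by (simp add: comult_simps counit_simps H.smult_smult mult.commute)
  qed (simp_all add: comult_simps counit_simps linear_mapsD[OF conv_right_linear] H.smult_add_left H.smult_smult)
  then show "mult_map H (tensor_map H H id S (\<Delta> x)) = \<epsilon> x \<odot> \<one>" by (simp only: conv_right_def)
qed

lemmas coassoc_maps =
  tensor_map_linear[OF HHH.AB_C.tensor_product_axioms HH.tensor_product_axioms alg_homsD(1)[OF comult] linear_maps_id]
  tensor_map_linear[OF HHH.A_BC.tensor_product_axioms HH.tensor_product_axioms linear_maps_id alg_homsD(1)[OF comult]]
  tensor_map_pure[OF HHH.AB_C.tensor_product_axioms HH.tensor_product_axioms alg_homsD(1)[OF comult] linear_maps_id]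
  tensor_map_pure[OF HHH.A_BC.tensor_product_axioms HH.tensor_product_axioms linear_maps_id alg_homsD(1)[OF comult]]

lemmas counit_maps =
  tensor_map_linear[OF CH.tensor_product_axioms HH.tensor_product_axioms alg_homsD(1)[OF counit] linear_maps_id]
  tensor_map_linear[OF HC.tensor_product_axioms HH.tensor_product_axioms linear_maps_id alg_homsD(1)[OF counit]]
  tensor_map_pure[OF CH.tensor_product_axioms HH.tensor_product_axioms alg_homsD(1)[OF counit] linear_maps_id]
  tensor_map_pure[OF HC.tensor_product_axioms HH.tensor_product_axioms linear_maps_id alg_homsD(1)[OF counit]]

lemma grouplike_hopf_axioms:
  assumes "g \<in> carrier H" "\<Delta> g = HH.pure g g" "\<epsilon> g = 1" "S g \<otimes> g = \<one>" "g \<otimes> S g = \<one>"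
  shows "hopf_axioms_at H \<Delta> \<epsilon> S g"
  unfolding hopf_axioms_at_def conv_left_def[symmetric] conv_right_def[symmetric]
  using assms by (simp add: coassoc_maps(3,4) counit_maps(3,4) HHH.tensor_assoc_pure conv_left_pure conv_right_pure)

text \<open>Both sides of coassociativity are \<open>d \<otimes> 1 \<otimes> 1 + g \<otimes> d \<otimes> 1 + g \<otimes> g \<otimes> d\<close>. The counit leaves one of the two
  terms of \<open>\<Delta> d\<close>, and the value of \<open>S d\<close> is the one for which the two terms cancel in the antipode axioms.\<close>

lemma skew_primitive_hopf_axioms:
  assumes d: "d \<in> carrier H" "\<Delta> d = HH.pure d \<one> \<oplus>\<^bsub>HH.T\<^esub> HH.pure g d" "\<epsilon> d = 0" "S d = \<ominus> (S g \<otimes> d)"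
    and g: "g \<in> carrier H" "\<Delta> g = HH.pure g g" "\<epsilon> g = 1" "g \<otimes> S g = \<one>"
  shows "hopf_axioms_at H \<Delta> \<epsilon> S d"
proof -
  have Sg: "S g \<in> carrier H" using g(1) by (simp add: S_simps)
  note maps = coassoc_maps(3,4) counit_maps(3,4) linear_mapsD(2)[OF coassoc_maps(1)]
    linear_mapsD(2)[OF coassoc_maps(2)] linear_mapsD(2)[OF counit_maps(1)] linear_mapsD(2)[OF counit_maps(2)]
  have one: "\<Delta> \<one> = HH.pure \<one> \<one>" "\<epsilon> \<one> = 1" using comult_simps(1) counit_simps(1) by (simp_all add: HH.pure_one)
  have "tensor_assoc H H H (tensor_map HH.T H \<Delta> id (\<Delta> d)) = tensor_map H HH.T id \<Delta> (\<Delta> d)"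
    using d(1) g(1)
    by (simp add: maps d(2) g(2) one HHH.AB_C.pure_add_left HHH.A_BC.pure_add_right HHH.tensor_assoc_pure
        linear_mapsD(2)[OF alg_homsD(1)[OF HHH.tensor_assoc_alg_hom]] HHH.A_BC.T.M.a_assoc)
  moreover have "CH.pure 0 \<one> = \<zero>\<^bsub>CH.T\<^esub>" "HC.pure g 0 = \<zero>\<^bsub>HC.T\<^esub>"
    using CH.pure_smult_left[of 0 "\<one>" 0] HC.pure_smult_right[of g 0 0] g(1) by simp_all
  then have "tensor_map complexes H \<epsilon> id (\<Delta> d) = CH.pure 1 d" "tensor_map H complexes id \<epsilon> (\<Delta> d) = HC.pure d 1"
    using d(1) g(1) by (simp_all add: maps d(2,3) g(3) one)
  moreover have "conv_left (\<Delta> d) = \<epsilon> d \<odot> \<one>"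
    using d(1) g(1) Sg
    by (simp add: d(2,3,4) linear_mapsD(2)[OF conv_left_linear] conv_left_pure H.M.l_neg)
  moreover have "conv_right (\<Delta> d) = \<epsilon> d \<odot> \<one>"
    using d(1) g(1) Sg
    by (simp add: d(2,3,4) linear_mapsD(2)[OF conv_right_linear] conv_right_pure antipode_one
        H.r_minus H.m_assoc[symmetric] g(4) H.M.r_neg)
  ultimately show ?thesis
    unfolding hopf_axioms_at_def conv_left_def[symmetric] conv_right_def[symmetric] by blast
qed

end

section \<open>The derivation algebra by generators and relations\<close>

text \<open>Elements of an algebra that satisfy the relations of the generators \<open>\<partial>\<^sub>i\<close>, \<open>\<sigma>\<^sub>i\<close>, \<open>\<sigma>\<^sub>i\<^sup>-\<^sup>1\<close>, with the
  coefficients \<open>\<eta>(\<epsilon>\<^sub>i, \<epsilon>\<^sub>j)\<close> evaluated to \<open>q\<^sup>j\<^sup>-\<^sup>i\<close>. Naming this notion lets the same relations be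
  checked in \<open>A \<otimes> A\<close>, in the opposite algebra and in \<open>\<complex>\<close>.\<close>

locale derivation_system = complex_algebra A for A (structure) +
  fixes n :: nat and q :: complex and d s t :: "nat \<Rightarrow> 'a"
  assumes closed [simp]:
      "i \<in> {1..n} \<Longrightarrow> d i \<in> carrier A" "i \<in> {1..n} \<Longrightarrow> s i \<in> carrier A" "i \<in> {1..n} \<Longrightarrow> t i \<in> carrier A"
    and d_d: "\<lbrakk>i \<in> {1..n}; j \<in> {1..n}\<rbrakk> \<Longrightarrow> d i \<otimes> d j = (q powi (int j - int i)) \<odot> (d j \<otimes> d i)"
    and s_s: "\<lbrakk>i \<in> {1..n}; j \<in> {1..n}\<rbrakk> \<Longrightarrow> s i \<otimes> s j = s j \<otimes> s i"
    and s_d: "\<lbrakk>i \<in> {1..n}; j \<in> {1..n}\<rbrakk> \<Longrightarrow> s j \<otimes> d i = (q powi (int i - int j)) \<odot> (d i \<otimes> s j)"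
    and s_t [simp]: "i \<in> {1..n} \<Longrightarrow> s i \<otimes> t i = \<one>"
    and t_s [simp]: "i \<in> {1..n} \<Longrightarrow> t i \<otimes> s i = \<one>"

lemma monoid_free_monoid: "Group.monoid (free_monoid X)"
  by (rule monoidI) (auto simp: free_monoid_def)

lemma free_monoid_simps [simp]:
  "carrier (free_monoid X) = lists X" "u \<otimes>\<^bsub>free_monoid X\<^esub> v = u @ v" "\<one>\<^bsub>free_monoid X\<^esub> = []"
  by (simp_all add: free_monoid_def)

definition word_value where
  "word_value A v w = foldr (\<lambda>g x. v g \<otimes>\<^bsub>A\<^esub> x) w \<one>\<^bsub>A\<^esub>"

lemma (in complex_algebra)
  assumes "v \<in> X \<rightarrow> carrier A"
  shows word_value_closed: "w \<in> lists X \<Longrightarrow> word_value A v w \<in> carrier A"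
    and word_value_append:
      "\<lbrakk>w \<in> lists X; w' \<in> lists X\<rbrakk> \<Longrightarrow> word_value A v (w @ w') = word_value A v w \<otimes> word_value A v w'"
proof -
  show closed: "word_value A v w \<in> carrier A" if "w \<in> lists X" for w
    using that by induction (use assms in \<open>auto simp: word_value_def\<close>)
  show "word_value A v (w @ w') = word_value A v w \<otimes> word_value A v w'"
    if "w \<in> lists X" "w' \<in> lists X" for w w'
    using that
  proof induction
    case Nil
    then show ?case using closed by (simp add: word_value_def)
  next
    case (Cons g w)
    then have "v g \<in> carrier A" using assms by blast
    then show ?case using Cons closed[of w] closed[of w']
      by (simp add: word_value_def m_assoc)
  qed
qed

lemma gens_cases [consumes 1, case_names partial sigma sigma_inv]:
  assumes "g \<in> gens n"
  obtains i where "i \<in> {1..n}" "g = Gen_partial i" | i where "i \<in> {1..n}" "g = Gen_sigma i"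
    | i where "i \<in> {1..n}" "g = Gen_sigma_inv i"
  using assms by (auto simp: gens_def)

lemma gen_in:
  "i \<in> {1..n} \<Longrightarrow> Gen_partial i \<in> gens n" "i \<in> {1..n} \<Longrightarrow> Gen_sigma i \<in> gens n"
  "i \<in> {1..n} \<Longrightarrow> Gen_sigma_inv i \<in> gens n"
  by (auto simp: gens_def)

definition sigma_inv_elt :: "nat \<Rightarrow> complex \<Rightarrow> nat \<Rightarrow> (gen list \<Rightarrow>\<^sub>0 complex) set" where
  "sigma_inv_elt n q i =
     derivation_ideal n q +>\<^bsub>free_algebra n\<^esub> Poly_Mapping.single [Gen_sigma_inv i] 1"

definition word_elt :: "nat \<Rightarrow> complex \<Rightarrow> gen list \<Rightarrow> (gen list \<Rightarrow>\<^sub>0 complex) set" where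
  "word_elt n q w = derivation_ideal n q +>\<^bsub>free_algebra n\<^esub> Poly_Mapping.single w 1"

lemma derivation_relators_mem:
  assumes i: "i \<in> {1..n}" and j: "j \<in> {1..n}"
  shows "Poly_Mapping.single [Gen_partial i, Gen_partial j] 1 - Poly_Mapping.single [Gen_partial j, Gen_partial i] (q powi (int j - int i)) \<in> derivation_relators n q"
    and "Poly_Mapping.single [Gen_sigma i, Gen_sigma j] 1 - Poly_Mapping.single [Gen_sigma j, Gen_sigma i] 1 \<in> derivation_relators n q"
    and "Poly_Mapping.single [Gen_sigma j, Gen_partial i] 1 - Poly_Mapping.single [Gen_partial i, Gen_sigma j] (q powi (int i - int j)) \<in> derivation_relators n q"
    and "Poly_Mapping.single [Gen_sigma i, Gen_sigma_inv i] 1 - Poly_Mapping.single [] 1 \<in> derivation_relators n q"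
    and "Poly_Mapping.single [Gen_sigma_inv i, Gen_sigma i] 1 - Poly_Mapping.single [] 1 \<in> derivation_relators n q"
  unfolding derivation_relators_def eta_std_basis[OF i j, of q, symmetric] eta_std_basis[OF j i, of q, symmetric]
  by (rule UN_I[OF i], rule UN_I[OF j], simp)+

lemma derivation_relators_induct [consumes 1, case_names d_d s_s s_d s_t t_s]:
  assumes "r \<in> derivation_relators n q"
    and "\<And>i j. \<lbrakk>i \<in> {1..n}; j \<in> {1..n}\<rbrakk> \<Longrightarrow>
      P (Poly_Mapping.single [Gen_partial i, Gen_partial j] 1 - Poly_Mapping.single [Gen_partial j, Gen_partial i] (q powi (int j - int i)))"
    and "\<And>i j. \<lbrakk>i \<in> {1..n}; j \<in> {1..n}\<rbrakk> \<Longrightarrow>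
      P (Poly_Mapping.single [Gen_sigma i, Gen_sigma j] 1 - Poly_Mapping.single [Gen_sigma j, Gen_sigma i] 1)"
    and "\<And>i j. \<lbrakk>i \<in> {1..n}; j \<in> {1..n}\<rbrakk> \<Longrightarrow>
      P (Poly_Mapping.single [Gen_sigma j, Gen_partial i] 1 - Poly_Mapping.single [Gen_partial i, Gen_sigma j] (q powi (int i - int j)))"
    and "\<And>i. i \<in> {1..n} \<Longrightarrow>
      P (Poly_Mapping.single [Gen_sigma i, Gen_sigma_inv i] 1 - Poly_Mapping.single [] 1)"
    and "\<And>i. i \<in> {1..n} \<Longrightarrow>
      P (Poly_Mapping.single [Gen_sigma_inv i, Gen_sigma i] 1 - Poly_Mapping.single [] 1)"
  shows "P r"
  using assms(1) unfolding derivation_relators_def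
  by (elim UN_E insertE emptyE) (simp_all only: eta_std_basis assms(2-6))

text \<open>Fixes the parameters, so that the free algebra, the ideal and the quotient can be treated as algebras
  with their laws available.\<close>

locale derivation_presentation =
  fixes n :: nat and q :: complex
begin

abbreviation free where "free \<equiv> free_algebra n"
abbreviation I where "I \<equiv> derivation_ideal n q"
abbreviation D where "D \<equiv> derivation_algebra n q"

sublocale free: complex_algebra free
  by (rule complex_algebra_monoid_algebra[OF monoid_free_monoid])

lemma derivation_relators_closed: "derivation_relators n q \<subseteq> carrier free"
proof
  fix r assume "r \<in> derivation_relators n q"
  then show "r \<in> carrier free"
    by (induction r rule: derivation_relators_induct) (simp_all add: keys_diff_in gen_in)
qed

lemma ideal_derivation_ideal: "ideal (derivation_ideal n q) (free_algebra n)"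
  unfolding derivation_ideal_def by (rule free.genideal_ideal[OF derivation_relators_closed])

sublocale I: algebra_ideal free I
  unfolding algebra_ideal_def using ideal_derivation_ideal free.complex_algebra_axioms by blast

sublocale D: complex_algebra D
  unfolding derivation_algebra_def by (rule I.complex_algebra_quot)

lemmas coset_derivation_hom = I.coset_alg_hom[folded derivation_algebra_def]

lemma word_elt_closed: "w \<in> lists (gens n) \<Longrightarrow> word_elt n q w \<in> carrier D"
  unfolding word_elt_def by (rule linear_mapsD(1)[OF alg_homsD(1)[OF coset_derivation_hom]]) simp

lemma word_elt_append: "\<lbrakk>u \<in> lists (gens n); v \<in> lists (gens n)\<rbrakk> \<Longrightarrow>
    word_elt n q (u @ v) = word_elt n q u \<otimes>\<^bsub>D\<^esub> word_elt n q v"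
  unfolding word_elt_def
  using alg_homsD(3)[OF coset_derivation_hom, of "Poly_Mapping.single u 1" "Poly_Mapping.single v 1"]
  by simp

lemma word_elt_Nil: "word_elt n q [] = \<one>\<^bsub>D\<^esub>"
  unfolding word_elt_def using alg_homsD(2)[OF coset_derivation_hom] by simp

lemma word_elt_eqI:
  assumes "u \<in> lists (gens n)" "v \<in> lists (gens n)"
    and "Poly_Mapping.single u 1 - Poly_Mapping.single v c \<in> derivation_relators n q"
  shows "word_elt n q u = c \<odot>\<^bsub>D\<^esub> word_elt n q v"
proof -
  have "Poly_Mapping.single u 1 - Poly_Mapping.single v c \<in> I"
    using assms(3) free.genideal_self[OF derivation_relators_closed]
    unfolding derivation_ideal_def by blast
  then have "word_elt n q u = I +>\<^bsub>free\<^esub> Poly_Mapping.single v c"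
    unfolding word_elt_def
    by (intro I.coset_eqI) (use assms(1,2) in \<open>simp_all add: monoid_algebra_minus[OF monoid_free_monoid]\<close>)
  also have "\<dots> = c \<odot>\<^bsub>D\<^esub> word_elt n q v"
    unfolding word_elt_def
    using linear_mapsD(3)[OF alg_homsD(1)[OF coset_derivation_hom], of "Poly_Mapping.single v 1" c] assms(2)
    by simp
  finally show ?thesis .
qed

lemma word_elt_generator:
  "word_elt n q [Gen_partial i] = partial_elt n q i"
  "word_elt n q [Gen_sigma i] = sigma_elt n q i"
  "word_elt n q [Gen_sigma_inv i] = sigma_inv_elt n q i"
  by (simp_all add: word_elt_def partial_elt_def sigma_elt_def sigma_inv_elt_def)

lemma derivation_system_universal:
  "derivation_system D n q (partial_elt n q) (sigma_elt n q) (sigma_inv_elt n q)"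
proof
  note elt = word_elt_generator[symmetric]
  have two: "word_elt n q [g] \<otimes>\<^bsub>D\<^esub> word_elt n q [h] = word_elt n q [g, h]"
    if "g \<in> gens n" "h \<in> gens n" for g h
    using word_elt_append[of "[g]" "[h]"] that by simp
  fix i assume i: "i \<in> {1..n}"
  note mem = gen_in[OF i]
  show "partial_elt n q i \<in> carrier D"
    "sigma_elt n q i \<in> carrier D"
    "sigma_inv_elt n q i \<in> carrier D"
    unfolding elt by (intro word_elt_closed; simp add: mem)+
  have st: "word_elt n q [Gen_sigma i, Gen_sigma_inv i] = \<one>\<^bsub>D\<^esub>" "word_elt n q [Gen_sigma_inv i, Gen_sigma i] = \<one>\<^bsub>D\<^esub>"
    using word_elt_eqI[OF _ _ derivation_relators_mem(4)[OF i i]] word_elt_eqI[OF _ _ derivation_relators_mem(5)[OF i i]]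
    by (simp_all add: mem word_elt_Nil)
  show "sigma_elt n q i \<otimes>\<^bsub>D\<^esub> sigma_inv_elt n q i = \<one>\<^bsub>D\<^esub>"
    "sigma_inv_elt n q i \<otimes>\<^bsub>D\<^esub> sigma_elt n q i = \<one>\<^bsub>D\<^esub>"
    unfolding elt by (simp_all add: mem two st)
  fix j assume j: "j \<in> {1..n}"
  note mem = mem gen_in[OF j]
  show "partial_elt n q i \<otimes>\<^bsub>D\<^esub> partial_elt n q j =
      (q powi (int j - int i)) \<odot>\<^bsub>D\<^esub> (partial_elt n q j \<otimes>\<^bsub>D\<^esub> partial_elt n q i)"
    unfolding elt using word_elt_eqI[OF _ _ derivation_relators_mem(1)[OF i j]] by (simp add: mem two)
  show "sigma_elt n q i \<otimes>\<^bsub>D\<^esub> sigma_elt n q j = sigma_elt n q j \<otimes>\<^bsub>D\<^esub> sigma_elt n q i"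
    unfolding elt using word_elt_eqI[OF _ _ derivation_relators_mem(2)[OF i j]]
      word_elt_closed[of "[Gen_sigma j, Gen_sigma i]"] by (simp add: mem two)
  show "sigma_elt n q j \<otimes>\<^bsub>D\<^esub> partial_elt n q i =
      (q powi (int i - int j)) \<odot>\<^bsub>D\<^esub> (partial_elt n q i \<otimes>\<^bsub>D\<^esub> sigma_elt n q j)"
    unfolding elt using word_elt_eqI[OF _ _ derivation_relators_mem(3)[OF i j]] by (simp add: mem two)
qed

lemma derivation_algebra_generated:
  "subalgebra_generated D
     (partial_elt n q ` {1..n} \<union> sigma_elt n q ` {1..n} \<union> sigma_inv_elt n q ` {1..n})
   = carrier D" (is "?G = _")
proof
  interpret U: derivation_system D n q "partial_elt n q" "sigma_elt n q" "sigma_inv_elt n q"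
    by (rule derivation_system_universal)
  show "?G \<subseteq> carrier D"
  proof
    fix x assume "x \<in> ?G"
    then show "x \<in> carrier D" by induction auto
  qed
  have word: "word_elt n q w \<in> ?G" if "w \<in> lists (gens n)" for w
    using that
  proof induction
    case Nil
    then show ?case by (simp add: word_elt_Nil gen_one)
  next
    case (Cons g w)
    from Cons(1) have "word_elt n q [g] \<in> ?G"
      by (cases rule: gens_cases) (auto simp: word_elt_generator intro!: gen_base)
    then have "word_elt n q [g] \<otimes>\<^bsub>D\<^esub> word_elt n q w \<in> ?G" using Cons by (intro gen_mult)
    then show ?case using word_elt_append[of "[g]" w] Cons by simp
  qed
  show "carrier D \<subseteq> ?G"
  proof
    fix x assume "x \<in> carrier D"
    then obtain f where f: "Poly_Mapping.keys f \<subseteq> lists (gens n)"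
      and x: "x = I +>\<^bsub>free\<^esub> f"
      by (auto simp: derivation_algebra_def quot_algebra_simps)
    note proj = linear_mapsD[OF alg_homsD(1)[OF coset_derivation_hom]]
    have "lists (gens n) \<noteq> {}" by auto
    with f have "I +>\<^bsub>free\<^esub> f \<in> ?G"
    proof (induction f rule: free_induct)
      case (single w c)
      then have "c \<odot>\<^bsub>D\<^esub> word_elt n q w \<in> ?G" by (intro gen_smult word)
      then show ?case
        using proj(3)[of "Poly_Mapping.single w 1" c] single by (simp add: word_elt_def)
    next
      case (add f g)
      then show ?case using proj(2)[of f g] gen_add by simp
    qed
    then show "x \<in> ?G" by (simp only: x)
  qed
qed

end

text \<open>Universal property of the derivation algebra: evaluating words at the derivation system kills the
  relators, hence the ideal they generate, and descends to the quotient.\<close>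

lemma (in derivation_system) derivation_algebra_lift:
  obtains f where "f \<in> alg_homs (derivation_algebra n q) A"
    and "\<And>i. i \<in> {1..n} \<Longrightarrow> f (partial_elt n q i) = d i"
    and "\<And>i. i \<in> {1..n} \<Longrightarrow> f (sigma_elt n q i) = s i"
    and "\<And>i. i \<in> {1..n} \<Longrightarrow> f (sigma_inv_elt n q i) = t i"
proof
  interpret P: derivation_presentation n q .
  let ?v = "case_gen d s t"
  let ?F = "free_algebra n"
  let ?\<phi> = "lin_ext A (word_value A ?v)"
  have v: "?v \<in> gens n \<rightarrow> carrier A" by (auto elim!: gens_cases)
  then have vc: "?v g \<in> carrier A" if "g \<in> gens n" for g using that by blast
  note closed_word = word_value_closed[OF v]
  have hom: "?\<phi> \<in> alg_homs ?F A"
    by (rule monoid_algebra_lift[OF monoid_free_monoid complex_algebra_axioms])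
      (simp_all add: closed_word word_value_append[OF v], simp add: word_value_def)
  have lin: "?\<phi> \<in> linear_maps ?F A" by (rule alg_homsD(1)[OF hom])
  have word: "?\<phi> (Poly_Mapping.single w c) = c \<odot> word_value A ?v w" if "w \<in> lists (gens n)" for w c
    using lin_ext_single[OF vector_space, of "word_value A ?v" w c] closed_word[OF that] by blast
  have diff: "?\<phi> (Poly_Mapping.single u 1 - Poly_Mapping.single w c) = \<zero>"
    if "u \<in> lists (gens n)" "w \<in> lists (gens n)" "word_value A ?v u = c \<odot> word_value A ?v w" for u w c
    using linear_maps_minus[OF P.free.complex_algebra_axioms complex_algebra_axioms lin,
        of "Poly_Mapping.single u 1" "Poly_Mapping.single w c"] that
    by (simp add: monoid_algebra_minus[OF monoid_free_monoid] word closed_word)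
  have short_words: "word_value A ?v [] = \<one>"
    "g \<in> gens n \<Longrightarrow> word_value A ?v [g] = ?v g"
    "\<lbrakk>g \<in> gens n; h \<in> gens n\<rbrakk> \<Longrightarrow> word_value A ?v [g, h] = ?v g \<otimes> ?v h" for g h
    using vc by (simp_all add: word_value_def)
  have rel: "?\<phi> r = \<zero>" if "r \<in> derivation_relators n q" for r
    using that
  proof (induction r rule: derivation_relators_induct)
    case (d_d i j)
    note mem = gen_in[OF d_d(1)] gen_in[OF d_d(2)]
    show ?case by (rule diff) (simp_all add: mem short_words derivation_system.d_d[OF derivation_system_axioms d_d])
  next
    case (s_s i j)
    note mem = gen_in[OF s_s(1)] gen_in[OF s_s(2)]
    show ?case by (rule diff)
      (simp_all add: mem short_words derivation_system.s_s[OF derivation_system_axioms s_s] closed(2)[OF s_s(1)] closed(2)[OF s_s(2)])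
  next
    case (s_d i j)
    note mem = gen_in[OF s_d(1)] gen_in[OF s_d(2)]
    show ?case by (rule diff) (simp_all add: mem short_words derivation_system.s_d[OF derivation_system_axioms s_d])
  next
    case (s_t i)
    note mem = gen_in[OF s_t]
    show ?case by (rule diff) (simp_all add: mem short_words derivation_system.s_t[OF derivation_system_axioms s_t])
  next
    case (t_s i)
    note mem = gen_in[OF t_s]
    show ?case by (rule diff) (simp_all add: mem short_words derivation_system.t_s[OF derivation_system_axioms t_s])
  qed
  have "ideal {x \<in> carrier ?F. ?\<phi> x = \<zero>} ?F"
  proof (rule idealI)
    show "ring ?F" by unfold_locales
    have "submodule {x \<in> carrier ?F. ?\<phi> x \<in> {\<zero>}} complexes ?F"
      by (rule P.free.submodule_preimage[OF complex_algebra_axioms lin submodule_zero])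
    then show "subgroup {x \<in> carrier ?F. ?\<phi> x = \<zero>} (add_monoid ?F)" by (simp add: submodule_def)
  qed (simp_all add: alg_homsD(3)[OF hom] linear_mapsD(1)[OF lin] P.free.m_closed del: monoid_algebra_simps)
  then have "derivation_ideal n q \<subseteq> {x \<in> carrier ?F. ?\<phi> x = \<zero>}"
    unfolding derivation_ideal_def
    by (rule P.free.genideal_minimal) (use rel P.derivation_relators_closed in blast)
  then have ker: "?\<phi> x = \<zero>" if "x \<in> derivation_ideal n q" for x using that by blast
  let ?f = "\<lambda>X. the_elem (?\<phi> ` X)"
  show "?f \<in> alg_homs (derivation_algebra n q) A"
    unfolding derivation_algebra_def by (rule P.I.quot_lift_alg_hom[OF complex_algebra_axioms hom ker])
  have f_gen: "?f (word_elt n q [g]) = ?v g" if "g \<in> gens n" for g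
  proof -
    have "?f (word_elt n q [g]) = ?\<phi> (Poly_Mapping.single [g] 1)"
      unfolding word_elt_def by (rule P.I.quot_lift_coset[OF complex_algebra_axioms lin ker]) (use that in simp_all)
    also have "\<dots> = 1 \<odot> ?v g" using that by (simp add: word short_words)
    also have "\<dots> = ?v g" by (rule smult_1) (use v that in blast)
    finally show ?thesis .
  qed
  fix i assume i: "i \<in> {1..n}"
  show "?f (partial_elt n q i) = d i" "?f (sigma_elt n q i) = s i" "?f (sigma_inv_elt n q i) = t i"
    using gen_in[OF i, THEN f_gen] by (simp_all add: P.word_elt_generator)
qed

section \<open>Coproduct, counit and antipode\<close>

text \<open>Antihomomorphisms into \<open>A\<close> are homomorphisms into this algebra, so the universal property also
  constructs the antipode.\<close>

definition opposite :: "(complex, 'a, 'm) module_scheme \<Rightarrow> (complex, 'a, 'm) module_scheme" where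
  "opposite A = A\<lparr>mult := \<lambda>x y. y \<otimes>\<^bsub>A\<^esub> x\<rparr>"

lemma opposite_simps [simp]:
  "carrier (opposite A) = carrier A" "x \<otimes>\<^bsub>opposite A\<^esub> y = y \<otimes>\<^bsub>A\<^esub> x" "\<one>\<^bsub>opposite A\<^esub> = \<one>\<^bsub>A\<^esub>"
  "\<zero>\<^bsub>opposite A\<^esub> = \<zero>\<^bsub>A\<^esub>" "x \<oplus>\<^bsub>opposite A\<^esub> y = x \<oplus>\<^bsub>A\<^esub> y" "c \<odot>\<^bsub>opposite A\<^esub> x = c \<odot>\<^bsub>A\<^esub> x"
  by (simp_all add: opposite_def)

lemma (in complex_algebra) complex_algebra_opposite: "complex_algebra (opposite A)"
proof (rule complex_algebraI)
  have "abelian_group (opposite A)"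
  proof (rule abelian_groupI)
    fix x assume "x \<in> carrier (opposite A)"
    then show "\<exists>y\<in>carrier (opposite A). y \<oplus>\<^bsub>opposite A\<^esub> x = \<zero>\<^bsub>opposite A\<^esub>"
      by (intro bexI[of _ "\<ominus> x"]) (simp_all add: M.l_neg)
  qed (simp_all add: M.a_ac)
  moreover have "Group.monoid (opposite A)"
    by (rule monoidI) (simp_all add: m_assoc)
  ultimately show "ring (opposite A)"
    by (rule ringI) (simp_all add: l_distr r_distr)
qed (simp_all add: smult_add_left smult_add_right smult_smult smult_mult_left smult_mult_right)

lemma alg_antihoms_opposite: "f \<in> alg_homs A (opposite B) \<Longrightarrow> f \<in> alg_antihoms A B"
  by (auto simp: alg_homs_def alg_antihoms_def linear_maps_def ring_hom_def)

context derivation_system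
begin

lemma powi_cancel: "q \<noteq> 0 \<Longrightarrow> q powi (int i - int j) * q powi (int j - int i) = 1"
  by (simp flip: power_int_add)

text \<open>The relation between \<open>s\<^sub>j\<close> and \<open>d\<^sub>i\<close>, multiplied by \<open>t\<^sub>j\<close> on both sides.\<close>

lemma d_t:
  assumes i: "i \<in> {1..n}" and j: "j \<in> {1..n}"
  shows "d i \<otimes> t j = (q powi (int i - int j)) \<odot> (t j \<otimes> d i)"
proof -
  note [simp] = closed[OF i] closed[OF j]
  have "d i \<otimes> t j = t j \<otimes> (s j \<otimes> d i) \<otimes> t j"
    using t_s[OF j] by (simp add: m_assoc[symmetric])
  also have "\<dots> = (q powi (int i - int j)) \<odot> (t j \<otimes> d i \<otimes> (s j \<otimes> t j))"
    unfolding s_d[OF i j] by (simp add: smult_mult_left smult_mult_right m_assoc)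
  finally show ?thesis using s_t[OF j] by simp
qed

lemma t_t:
  assumes i: "i \<in> {1..n}" and j: "j \<in> {1..n}"
  shows "t i \<otimes> t j = t j \<otimes> t i"
proof -
  note [simp] = closed[OF i] closed[OF j]
  have "t i \<otimes> t j = t j \<otimes> (s j \<otimes> t i) \<otimes> t j"
    using t_s[OF j] by (simp add: m_assoc[symmetric])
  also have "s j \<otimes> t i = t i \<otimes> (s i \<otimes> s j) \<otimes> t i"
    using t_s[OF i] by (simp add: m_assoc[symmetric])
  also have "\<dots> = t i \<otimes> s j \<otimes> (s i \<otimes> t i)"
    unfolding s_s[OF i j] by (simp add: m_assoc)
  also have "t j \<otimes> (t i \<otimes> s j \<otimes> (s i \<otimes> t i)) \<otimes> t j = t j \<otimes> t i \<otimes> (s j \<otimes> t j)"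
    using s_t[OF i] by (simp add: m_assoc)
  finally show ?thesis using s_t[OF j] by simp
qed

text \<open>In the product of the elements with index \<open>i\<close> and \<open>j\<close>, the mixed terms \<open>d\<^sub>i s\<^sub>j \<otimes> d\<^sub>j\<close> and
  \<open>s\<^sub>i d\<^sub>j \<otimes> d\<^sub>i\<close> change places when \<open>i\<close> and \<open>j\<close> are exchanged, with exactly the factors needed.\<close>

lemma derivation_system_tensor:
  assumes q: "q \<noteq> 0"
  shows "derivation_system (A \<otimes>\<^sub>A A) n q
    (\<lambda>i. pure_tensor A A (d i) \<one> \<oplus>\<^bsub>A \<otimes>\<^sub>A A\<^esub> pure_tensor A A (s i) (d i))
    (\<lambda>i. pure_tensor A A (s i) (s i)) (\<lambda>i. pure_tensor A A (t i) (t i))"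
proof -
  interpret AA: tensor_product A A by unfold_locales
  show ?thesis
  proof
    fix i assume i: "i \<in> {1..n}"
    note [simp] = closed[OF i]
    show "AA.pure (d i) \<one> \<oplus>\<^bsub>AA.T\<^esub> AA.pure (s i) (d i) \<in> carrier AA.T"
      "AA.pure (s i) (s i) \<in> carrier AA.T" "AA.pure (t i) (t i) \<in> carrier AA.T" by simp_all
    show "AA.pure (s i) (s i) \<otimes>\<^bsub>AA.T\<^esub> AA.pure (t i) (t i) = \<one>\<^bsub>AA.T\<^esub>"
      "AA.pure (t i) (t i) \<otimes>\<^bsub>AA.T\<^esub> AA.pure (s i) (s i) = \<one>\<^bsub>AA.T\<^esub>"
      using s_t[OF i] t_s[OF i] by (simp_all add: AA.pure_mult AA.pure_one)
    fix j assume j: "j \<in> {1..n}"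
    note [simp] = closed[OF j]
    let ?c = "q powi (int j - int i)" and ?c' = "q powi (int i - int j)"
    let ?P = "AA.pure (d j \<otimes> d i) \<one>" and ?Q = "AA.pure (d i \<otimes> s j) (d j)"
      and ?R = "AA.pure (d j \<otimes> s i) (d i)" and ?S = "AA.pure (s j \<otimes> s i) (d j \<otimes> d i)"
    note expand = AA.T.l_distr AA.T.r_distr AA.pure_mult AA.pure_smult_left AA.pure_smult_right
      AA.T.smult_add_right AA.T.smult_smult
    have "(AA.pure (d i) \<one> \<oplus>\<^bsub>AA.T\<^esub> AA.pure (s i) (d i)) \<otimes>\<^bsub>AA.T\<^esub> (AA.pure (d j) \<one> \<oplus>\<^bsub>AA.T\<^esub> AA.pure (s j) (d j))
        = (?c \<odot>\<^bsub>AA.T\<^esub> ?P \<oplus>\<^bsub>AA.T\<^esub> ?Q) \<oplus>\<^bsub>AA.T\<^esub> (?c \<odot>\<^bsub>AA.T\<^esub> ?R \<oplus>\<^bsub>AA.T\<^esub> ?c \<odot>\<^bsub>AA.T\<^esub> ?S)"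
      using d_d[OF i j] s_d[OF j i] s_s[OF i j] by (simp add: expand AA.T.M.a_ac)
    moreover have "?c \<odot>\<^bsub>AA.T\<^esub>
        ((AA.pure (d j) \<one> \<oplus>\<^bsub>AA.T\<^esub> AA.pure (s j) (d j)) \<otimes>\<^bsub>AA.T\<^esub> (AA.pure (d i) \<one> \<oplus>\<^bsub>AA.T\<^esub> AA.pure (s i) (d i)))
        = (?c \<odot>\<^bsub>AA.T\<^esub> ?P \<oplus>\<^bsub>AA.T\<^esub> ?c \<odot>\<^bsub>AA.T\<^esub> ?R) \<oplus>\<^bsub>AA.T\<^esub> (?Q \<oplus>\<^bsub>AA.T\<^esub> ?c \<odot>\<^bsub>AA.T\<^esub> ?S)"
      using s_d[OF i j] powi_cancel[OF q, of j i] by (simp add: expand AA.T.M.a_ac)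
    ultimately show "(AA.pure (d i) \<one> \<oplus>\<^bsub>AA.T\<^esub> AA.pure (s i) (d i)) \<otimes>\<^bsub>AA.T\<^esub> (AA.pure (d j) \<one> \<oplus>\<^bsub>AA.T\<^esub> AA.pure (s j) (d j))
        = ?c \<odot>\<^bsub>AA.T\<^esub>
        ((AA.pure (d j) \<one> \<oplus>\<^bsub>AA.T\<^esub> AA.pure (s j) (d j)) \<otimes>\<^bsub>AA.T\<^esub> (AA.pure (d i) \<one> \<oplus>\<^bsub>AA.T\<^esub> AA.pure (s i) (d i)))"
      by (simp add: AA.T.M.a_ac)
    show "AA.pure (s i) (s i) \<otimes>\<^bsub>AA.T\<^esub> AA.pure (s j) (s j) = AA.pure (s j) (s j) \<otimes>\<^bsub>AA.T\<^esub> AA.pure (s i) (s i)"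
      using s_s[OF i j] by (simp add: AA.pure_mult)
    show "AA.pure (s j) (s j) \<otimes>\<^bsub>AA.T\<^esub> (AA.pure (d i) \<one> \<oplus>\<^bsub>AA.T\<^esub> AA.pure (s i) (d i))
        = ?c' \<odot>\<^bsub>AA.T\<^esub> ((AA.pure (d i) \<one> \<oplus>\<^bsub>AA.T\<^esub> AA.pure (s i) (d i)) \<otimes>\<^bsub>AA.T\<^esub> AA.pure (s j) (s j))"
      using s_d[OF i j] s_s[OF i j] by (simp add: expand)
  qed
qed

text \<open>The inverses \<open>t\<^sub>j\<close> move past \<open>d\<^sub>i\<close> with the inverse factors (\<open>d_t\<close>). Bringing
  \<open>t\<^sub>i d\<^sub>i t\<^sub>j d\<^sub>j\<close> to the form \<open>t\<^sub>i t\<^sub>j d\<^sub>j d\<^sub>i\<close> costs \<open>q\<^sup>i\<^sup>-\<^sup>j\<close> for the first exchange and \<open>q\<^sup>j\<^sup>-\<^sup>i\<close> for the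
  second, so nothing, whereas the reversed product keeps a single factor.\<close>

lemma derivation_system_opposite:
  assumes q: "q \<noteq> 0"
  shows "derivation_system (opposite A) n q (\<lambda>i. \<ominus> (t i \<otimes> d i)) t s"
proof (intro derivation_system.intro complex_algebra_opposite derivation_system_axioms.intro)
  fix i assume i: "i \<in> {1..n}"
  note [simp] = closed[OF i]
  show "\<ominus> (t i \<otimes> d i) \<in> carrier (opposite A)" "t i \<in> carrier (opposite A)" "s i \<in> carrier (opposite A)" by simp_all
  show "t i \<otimes>\<^bsub>opposite A\<^esub> s i = \<one>\<^bsub>opposite A\<^esub>" "s i \<otimes>\<^bsub>opposite A\<^esub> t i = \<one>\<^bsub>opposite A\<^esub>"
    using s_t[OF i] t_s[OF i] by simp_all
  fix j assume j: "j \<in> {1..n}"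
  note [simp] = closed[OF j]
  let ?c = "q powi (int j - int i)" and ?c' = "q powi (int i - int j)"
  show "t i \<otimes>\<^bsub>opposite A\<^esub> t j = t j \<otimes>\<^bsub>opposite A\<^esub> t i" using t_t[OF i j] by simp
  have "t i \<otimes> (d i \<otimes> t j) = ?c' \<odot> (t j \<otimes> (t i \<otimes> d i))"
    unfolding d_t[OF i j] using t_t[OF i j] by (simp add: smult_mult_right m_assoc[symmetric])
  then show "t j \<otimes>\<^bsub>opposite A\<^esub> \<ominus> (t i \<otimes> d i) = ?c' \<odot>\<^bsub>opposite A\<^esub> (\<ominus> (t i \<otimes> d i) \<otimes>\<^bsub>opposite A\<^esub> t j)"
    by (simp add: smult_minus1[symmetric] smult_mult_left smult_mult_right smult_smult m_assoc mult.commute)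
  have ij: "t k \<otimes> d k \<otimes> (t l \<otimes> d l) = (q powi (int k - int l)) \<odot> (t k \<otimes> t l \<otimes> (d k \<otimes> d l))"
    if k: "k \<in> {1..n}" and l: "l \<in> {1..n}" for k l
  proof -
    note [simp] = closed[OF k] closed[OF l]
    have "t k \<otimes> d k \<otimes> (t l \<otimes> d l) = t k \<otimes> (d k \<otimes> t l) \<otimes> d l" by (simp add: m_assoc)
    then show ?thesis unfolding d_t[OF k l] by (simp add: smult_mult_left smult_mult_right m_assoc)
  qed
  have "t j \<otimes> d j \<otimes> (t i \<otimes> d i) = ?c \<odot> (t i \<otimes> t j \<otimes> (d j \<otimes> d i))"
    using ij[OF j i] t_t[OF i j] by simp
  moreover have "t i \<otimes> d i \<otimes> (t j \<otimes> d j) = t i \<otimes> t j \<otimes> (d j \<otimes> d i)"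
    using ij[OF i j] d_d[OF i j] powi_cancel[OF q, of i j]
    by (simp add: smult_mult_right smult_smult)
  ultimately show "\<ominus> (t i \<otimes> d i) \<otimes>\<^bsub>opposite A\<^esub> \<ominus> (t j \<otimes> d j)
      = ?c \<odot>\<^bsub>opposite A\<^esub> (\<ominus> (t j \<otimes> d j) \<otimes>\<^bsub>opposite A\<^esub> \<ominus> (t i \<otimes> d i))"
    by (simp add: l_minus r_minus)
qed

end

lemma derivation_system_complexes: "derivation_system complexes n q (\<lambda>i. 0) (\<lambda>i. 1) (\<lambda>i. 1)"
  by (intro derivation_system.intro complex_algebra_complexes derivation_system_axioms.intro) simp_all

theorem theorem4p1:
  fixes n :: nat and q :: complex
  assumes "n \<ge> 1" and "q \<noteq> 0"
  shows "let D = derivation_algebra n q; d = partial_elt n q; \<sigma> = sigma_elt n q in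
    \<exists>\<Delta> \<epsilon> S. hopf_algebra D \<Delta> \<epsilon> S \<and> S \<in> alg_antihoms D D \<and>
      (\<forall>i\<in>{1..n}.
         \<Delta> (\<sigma> i) = pure_tensor D D (\<sigma> i) (\<sigma> i) \<and>
         \<Delta> (d i) = pure_tensor D D (d i) \<one>\<^bsub>D\<^esub> \<oplus>\<^bsub>D \<otimes>\<^sub>A D\<^esub> pure_tensor D D (\<sigma> i) (d i) \<and>
         \<epsilon> (\<sigma> i) = 1 \<and>
         \<epsilon> (d i) = 0 \<and>
         S (\<sigma> i) = inv\<^bsub>D\<^esub> (\<sigma> i) \<and>
         S (d i) = \<ominus>\<^bsub>D\<^esub> (inv\<^bsub>D\<^esub> (\<sigma> i) \<otimes>\<^bsub>D\<^esub> d i))"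
proof -
  interpret P: derivation_presentation n q .
  let ?D = "derivation_algebra n q"
  let ?d = "partial_elt n q" and ?\<sigma> = "sigma_elt n q" and ?\<tau> = "sigma_inv_elt n q"
  interpret U: derivation_system ?D n q ?d ?\<sigma> ?\<tau>
    by (rule P.derivation_system_universal)
  obtain \<Delta> where \<Delta>: "\<Delta> \<in> alg_homs ?D (?D \<otimes>\<^sub>A ?D)"
    and \<Delta>_gen: "\<And>i. i \<in> {1..n} \<Longrightarrow> \<Delta> (?d i) = pure_tensor ?D ?D (?d i) \<one>\<^bsub>?D\<^esub> \<oplus>\<^bsub>?D \<otimes>\<^sub>A ?D\<^esub> pure_tensor ?D ?D (?\<sigma> i) (?d i)"
      "\<And>i. i \<in> {1..n} \<Longrightarrow> \<Delta> (?\<sigma> i) = pure_tensor ?D ?D (?\<sigma> i) (?\<sigma> i)"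
      "\<And>i. i \<in> {1..n} \<Longrightarrow> \<Delta> (?\<tau> i) = pure_tensor ?D ?D (?\<tau> i) (?\<tau> i)"
    using derivation_system.derivation_algebra_lift[OF U.derivation_system_tensor[OF assms(2)]] by blast
  obtain \<epsilon> where \<epsilon>: "\<epsilon> \<in> alg_homs ?D complexes"
    and \<epsilon>_gen: "\<And>i. i \<in> {1..n} \<Longrightarrow> \<epsilon> (?d i) = 0" "\<And>i. i \<in> {1..n} \<Longrightarrow> \<epsilon> (?\<sigma> i) = 1"
      "\<And>i. i \<in> {1..n} \<Longrightarrow> \<epsilon> (?\<tau> i) = 1"
    using derivation_system.derivation_algebra_lift[OF derivation_system_complexes] by blast
  obtain S where "S \<in> alg_homs ?D (opposite ?D)"
    and S_gen: "\<And>i. i \<in> {1..n} \<Longrightarrow> S (?d i) = \<ominus>\<^bsub>?D\<^esub> (?\<tau> i \<otimes>\<^bsub>?D\<^esub> ?d i)"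
      "\<And>i. i \<in> {1..n} \<Longrightarrow> S (?\<sigma> i) = ?\<tau> i" "\<And>i. i \<in> {1..n} \<Longrightarrow> S (?\<tau> i) = ?\<sigma> i"
    using derivation_system.derivation_algebra_lift[OF U.derivation_system_opposite[OF assms(2)]] by blast
  then have S: "S \<in> alg_antihoms ?D ?D" by (intro alg_antihoms_opposite)
  interpret H: hopf_data ?D \<Delta> \<epsilon> S
    by unfold_locales (rule \<Delta> \<epsilon> S)+
  have "hopf_algebra ?D \<Delta> \<epsilon> S"
  proof (rule H.hopf_algebra_from_generators[OF _ P.derivation_algebra_generated])
    show "?d ` {1..n} \<union> ?\<sigma> ` {1..n} \<union> ?\<tau> ` {1..n} \<subseteq> carrier ?D" using U.closed by blast
    have "hopf_axioms_at ?D \<Delta> \<epsilon> S (?d i) \<and> hopf_axioms_at ?D \<Delta> \<epsilon> S (?\<sigma> i) \<and> hopf_axioms_at ?D \<Delta> \<epsilon> S (?\<tau> i)"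
      if i: "i \<in> {1..n}" for i
      using U.closed[OF i] \<Delta>_gen[OF i] \<epsilon>_gen[OF i] S_gen[OF i] U.s_t[OF i] U.t_s[OF i]
      by (intro conjI H.skew_primitive_hopf_axioms[of _ "?\<sigma> i"] H.grouplike_hopf_axioms) simp_all
    then show "hopf_axioms_at ?D \<Delta> \<epsilon> S x" if "x \<in> ?d ` {1..n} \<union> ?\<sigma> ` {1..n} \<union> ?\<tau> ` {1..n}" for x
      using that by blast
  qed
  moreover have "inv\<^bsub>?D\<^esub> (?\<sigma> i) = ?\<tau> i" if i: "i \<in> {1..n}" for i
    using P.D.inv_char[OF U.closed(2)[OF i] U.closed(3)[OF i] U.s_t[OF i] U.t_s[OF i]] .
  ultimately show ?thesis
    unfolding Let_def using S \<Delta>_gen \<epsilon>_gen S_gen by (intro exI[of _ \<Delta>] exI[of _ \<epsilon>] exI[of _ S]) simp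
qed

end
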